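(* Let $K$ be an algebraically closed field and let $n\ge 3$. Let $\mathscr Y_{n,n-2,n-2}$ be the locally closed subset of the affine space of $n\times n$ matrices over $K$ consisting of the matrices of rank exactly $n-2$ all of whose principal minors of size $n-2$ vanish. Then $$\dim \mathscr Y_{n,n-2,n-2}=n^2-4-n.$$
   Context: A minor of a square matrix is principal if it is defined by the same set of row and column indices. The space of $n\times n$ matrices over $K$ is identified with $\operatorname{Spec}K[X]$, i.e. affine space $\mathbb A^{n^2}$, where $X=(x_{ij})$ is a generic $n\times n$ matrix, with its Zariski topology; dimension means Krull dimension. *)

theory Defs
  imports
    "HOL-Library.Poly_Mapping"
    "HOL-Library.Extended_Real"
    "HOL-Analysis.Abstract_Topology"
    "Jordan_Normal_Form.DL_Rank_Submatrix"
begin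

definition irreducible_closedin :: "'a topology \<Rightarrow> 'a set \<Rightarrow> bool" where
  "irreducible_closedin X Z \<longleftrightarrow>
     closedin X Z \<and> Z \<noteq> {} \<and>
     (\<forall>A B. closedin X A \<and> closedin X B \<and> Z = A \<union> B \<longrightarrow> Z = A \<or> Z = B)"

text \<open>The value is \<open>-\<infinity>\<close> for the empty space and \<open>\<infinity>\<close> if chains are arbitrarily long.\<close>

definition krull_dim :: "'a topology \<Rightarrow> ereal" where
  "krull_dim X =
     (SUP d \<in> {d. \<exists>Z. (\<forall>i\<le>d. irreducible_closedin X (Z i)) \<and> (\<forall>i<d. Z i \<subset> Z (Suc i))}.
        ereal (real d))"

text \<open>Monomials are finitely supported exponent functions; the pair \<open>(i, j)\<close> stands for the
  variable \<open>x\<^sub>i\<^sub>j\<close>, with indices counted from 0.\<close>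

type_synonym 'a mat_poly = "((nat \<times> nat) \<Rightarrow>\<^sub>0 nat) \<Rightarrow>\<^sub>0 'a"

text \<open>The ring \<open>K[X]\<close> for a generic \<open>n \<times> n\<close> matrix \<open>X\<close>.\<close>

definition mat_polys :: "nat \<Rightarrow> 'a::comm_ring_1 mat_poly set" where
  "mat_polys n = {p. \<forall>m \<in> Poly_Mapping.keys p. Poly_Mapping.keys m \<subseteq> {..<n} \<times> {..<n}}"

definition eval_monom :: "((nat \<times> nat) \<Rightarrow>\<^sub>0 nat) \<Rightarrow> 'a::comm_ring_1 mat \<Rightarrow> 'a" where
  "eval_monom m A = (\<Prod>ij \<in> Poly_Mapping.keys m. (A $$ ij) ^ Poly_Mapping.lookup m ij)"

definition eval_poly :: "'a::comm_ring_1 mat_poly \<Rightarrow> 'a mat \<Rightarrow> 'a" where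
  "eval_poly p A = (\<Sum>m \<in> Poly_Mapping.keys p. Poly_Mapping.lookup p m * eval_monom m A)"

definition zero_locus :: "nat \<Rightarrow> 'a::comm_ring_1 mat_poly set \<Rightarrow> 'a mat set" where
  "zero_locus n S = {A \<in> carrier_mat n n. \<forall>p \<in> S. eval_poly p A = 0}"

definition zariski_open :: "nat \<Rightarrow> 'a::idom mat set \<Rightarrow> bool" where
  "zariski_open n U \<longleftrightarrow> (\<exists>S \<subseteq> mat_polys n. U = carrier_mat n n - zero_locus n S)"

definition zariski_topology :: "nat \<Rightarrow> 'a::idom mat topology" where
  "zariski_topology n = topology (zariski_open n)"

text \<open>The constant \<open>topology\<close> is only meaningful on families satisfying the axioms of open sets,
  which are verified next.\<close>

lemma eval_monom_superset:
  assumes "finite V" "Poly_Mapping.keys m \<subseteq> V"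
  shows "eval_monom m A = (\<Prod>ij \<in> V. (A $$ ij) ^ Poly_Mapping.lookup m ij)"
  unfolding eval_monom_def
  by (rule prod.mono_neutral_left) (use assms in \<open>auto simp: in_keys_iff\<close>)

lemma eval_monom_add: "eval_monom (m + m') A = eval_monom m A * eval_monom m' A"
proof -
  let ?V = "Poly_Mapping.keys m \<union> Poly_Mapping.keys m'"
  have "Poly_Mapping.keys (m + m') \<subseteq> ?V"
    by (rule Poly_Mapping.keys_add)
  then show ?thesis
    by (simp add: eval_monom_superset[of ?V] lookup_add power_add prod.distrib)
qed

lemma eval_poly_superset:
  assumes "finite M" "Poly_Mapping.keys p \<subseteq> M"
  shows "eval_poly p A = (\<Sum>m \<in> M. Poly_Mapping.lookup p m * eval_monom m A)"
  unfolding eval_poly_def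
  by (rule sum.mono_neutral_left) (use assms in \<open>auto simp: in_keys_iff\<close>)

lemma eval_poly_zero [simp]: "eval_poly 0 A = 0"
  by (simp add: eval_poly_def)

lemma eval_poly_single [simp]: "eval_poly (Poly_Mapping.single m c) A = c * eval_monom m A"
  by (subst eval_poly_superset[of "{m}"]) (auto simp: lookup_single)

lemma eval_poly_add: "eval_poly (p + q) A = eval_poly p A + eval_poly q A"
proof -
  let ?M = "Poly_Mapping.keys p \<union> Poly_Mapping.keys q"
  have "Poly_Mapping.keys (p + q) \<subseteq> ?M"
    by (rule Poly_Mapping.keys_add)
  then show ?thesis
    by (simp add: eval_poly_superset[of ?M] lookup_add algebra_simps sum.distrib)
qed

lemma eval_poly_sum: "eval_poly (sum f I) A = (\<Sum>i\<in>I. eval_poly (f i) A)"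
  by (induction I rule: infinite_finite_induct) (auto simp: eval_poly_add)

lemma mat_poly_decompose:
  "(p :: 'a::comm_ring_1 mat_poly) =
     (\<Sum>m \<in> Poly_Mapping.keys p. Poly_Mapping.single m (Poly_Mapping.lookup p m))"
  by (rule poly_mapping_eqI)
    (auto simp: lookup_sum lookup_single when_def in_keys_iff)

lemma eval_poly_mult: "eval_poly (p * q) A = eval_poly p A * eval_poly q A"
proof -
  have "p * q = (\<Sum>m \<in> Poly_Mapping.keys p. \<Sum>m' \<in> Poly_Mapping.keys q.
      Poly_Mapping.single (m + m') (Poly_Mapping.lookup p m * Poly_Mapping.lookup q m'))"
    by (subst mat_poly_decompose[of p], subst mat_poly_decompose[of q])
      (simp add: sum_product mult_single)
  then show ?thesis
    by (simp add: eval_poly_sum eval_monom_add eval_poly_def[of p] eval_poly_def[of q]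
        sum_product algebra_simps)
qed

lemma mat_polys_mult:
  assumes "p \<in> mat_polys n" "q \<in> mat_polys n"
  shows "p * q \<in> mat_polys n"
proof -
  have "Poly_Mapping.keys m \<subseteq> {..<n} \<times> {..<n}" if m: "m \<in> Poly_Mapping.keys (p * q)" for m
  proof -
    obtain a b where ab: "m = a + b" "a \<in> Poly_Mapping.keys p" "b \<in> Poly_Mapping.keys q"
      using m Poly_Mapping.keys_mult[of p q] by blast
    have "Poly_Mapping.keys m \<subseteq> Poly_Mapping.keys a \<union> Poly_Mapping.keys b"
      unfolding ab(1) by (rule Poly_Mapping.keys_add)
    then show ?thesis
      using ab assms unfolding mat_polys_def by blast
  qed
  then show ?thesis
    by (simp add: mat_polys_def)
qed

lemma istopology_zariski_open: "istopology (zariski_open n :: 'a::idom mat set \<Rightarrow> bool)"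
  unfolding istopology_def
proof (intro conjI allI impI)
  fix U V :: "'a mat set"
  assume "zariski_open n U" "zariski_open n V"
  then obtain S T where S: "S \<subseteq> mat_polys n" "U = carrier_mat n n - zero_locus n S"
    and T: "T \<subseteq> mat_polys n" "V = carrier_mat n n - zero_locus n T"
    unfolding zariski_open_def by blast
  let ?P = "{p * q |p q. p \<in> S \<and> q \<in> T}"
  have "?P \<subseteq> mat_polys n"
    using S(1) T(1) mat_polys_mult by blast
  moreover have "zero_locus n ?P = zero_locus n S \<union> zero_locus n T"
    by (auto simp: zero_locus_def eval_poly_mult) (metis eval_poly_mult mult_eq_0_iff)
  ultimately show "zariski_open n (U \<inter> V)"
    unfolding zariski_open_def using S(2) T(2) by (intro exI[of _ ?P]) auto
next
  fix \<U> :: "'a mat set set"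
  assume "\<forall>U\<in>\<U>. zariski_open n U"
  then obtain S where S: "\<And>U. U \<in> \<U> \<Longrightarrow> S U \<subseteq> mat_polys n"
    "\<And>U. U \<in> \<U> \<Longrightarrow> U = carrier_mat n n - zero_locus n (S U)"
    unfolding zariski_open_def by metis
  have "A \<in> \<Union>\<U> \<longleftrightarrow> A \<in> carrier_mat n n - zero_locus n (\<Union>U\<in>\<U>. S U)" for A
  proof -
    have "A \<in> \<Union>\<U> \<longleftrightarrow> (\<exists>U\<in>\<U>. A \<in> carrier_mat n n - zero_locus n (S U))"
      using S(2) by auto
    then show ?thesis
      by (auto simp: zero_locus_def)
  qed
  then have "\<Union>\<U> = carrier_mat n n - zero_locus n (\<Union>U\<in>\<U>. S U)"
    by blast
  then show "zariski_open n (\<Union>\<U>)"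
    unfolding zariski_open_def using S(1) by (intro exI[of _ "\<Union>U\<in>\<U>. S U"]) auto
qed

lemma openin_zariski: "openin (zariski_topology n) U \<longleftrightarrow> zariski_open n U"
  by (simp add: zariski_topology_def istopology_zariski_open)

lemma topspace_zariski [simp]:
  "topspace (zariski_topology n :: 'a::idom mat topology) = carrier_mat n n"
proof
  show "topspace (zariski_topology n :: 'a mat topology) \<subseteq> carrier_mat n n"
    by (auto simp: topspace_def openin_zariski zariski_open_def)
  have "eval_poly 1 A = 1" for A :: "'a mat"
    using eval_poly_single[of 0 1 A] by (simp add: eval_monom_def)
  then have "zero_locus n {1 :: 'a mat_poly} = {}"
    by (simp add: zero_locus_def)
  moreover have "{1 :: 'a mat_poly} \<subseteq> mat_polys n"
    by (simp add: mat_polys_def)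
  ultimately have "zariski_open n (carrier_mat n n :: 'a mat set)"
    unfolding zariski_open_def by (metis Diff_empty)
  then show "carrier_mat n n \<subseteq> topspace (zariski_topology n :: 'a mat topology)"
    by (metis openin_zariski openin_subset)
qed

lemma closedin_zariski:
  "closedin (zariski_topology n) C \<longleftrightarrow> (\<exists>S \<subseteq> mat_polys n. C = zero_locus n S)"
proof -
  have "zero_locus n S \<subseteq> carrier_mat n n" for S :: "'a mat_poly set"
    by (auto simp: zero_locus_def)
  then show ?thesis
    unfolding closedin_def openin_zariski zariski_open_def topspace_zariski
    by (metis Diff_Diff_Int inf.absorb_iff2)
qed

definition principal_minor :: "'a::comm_ring_1 mat \<Rightarrow> nat set \<Rightarrow> 'a" where
  "principal_minor A I = det (submatrix A I I)"

definition principal_minor_locus :: "nat \<Rightarrow> nat \<Rightarrow> nat \<Rightarrow> 'a::field mat set" where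
  "principal_minor_locus n r t =
     {A \<in> carrier_mat n n. vec_space.rank n A = r \<and>
        (\<forall>I \<subseteq> {..<n}. card I = t \<longrightarrow> principal_minor A I = 0)}"

end

theory Submission
  imports
    Defs
    "HOL-Library.Function_Algebras"
    "Jordan_Normal_Form.Matrix_Kernel"
begin

text \<open>A strictly increasing chain \<open>Z\<^sub>0 \<subset> \<dots> \<subset> Z\<^sub>e\<close> of irreducible closed sets yields \<open>e\<close>
  regular functions that are algebraically independent on \<open>Z\<^sub>e\<close>, whereas counting monomials shows
  that there are at most \<open>d\<close> such functions on a set on which all coordinates are polynomials in
  \<open>d\<close> functions.

  Let \<open>A\<close> have rank \<open>n - 2\<close>, let \<open>x, y\<close> span its left kernel and \<open>p, q\<close> its right kernel, and put
  \<open>v\<^sub>i = (x\<^sub>i, y\<^sub>i)\<close>, \<open>w\<^sub>i = (p\<^sub>i, q\<^sub>i)\<close>. The principal minor that omits \<open>i, j\<close> is non-zero as soon as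
  \<open>det (v\<^sub>i, v\<^sub>j)\<close> and \<open>det (w\<^sub>i, w\<^sub>j)\<close> are. So for vanishing minors, on the set of all \<open>i\<close> for which
  both \<open>v\<^sub>i\<close> and \<open>w\<^sub>i\<close> are non-zero, all the \<open>v\<^sub>i\<close> or all the \<open>w\<^sub>i\<close> are parallel. Up to transposition it
  is the \<open>v\<^sub>i\<close>; normalising both pairs, \<open>A\<close> is determined polynomially by an \<open>(n - 2) \<times> (n - 2)\<close>
  block and at most \<open>3n - 8\<close> kernel entries.

  The bound is attained by the matrices with a zero row whose right kernel lies in a coordinate
  hyperplane. An explicit polynomial family of these is irreducible because any two of its
  parameter points lie on a line, and freeing its parameters one at a time gives a chain.\<close>

subsection \<open>Algebraic independence of functions\<close>

text \<open>The rule \<open>gen_alg_cong\<close> makes membership depend on values on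
  \<open>X\<close> only, so this is the algebra generated by \<open>G\<close> inside the functions
  on \<open>X\<close>. Arbitrarily chosen functions, such as kernel coordinates of a matrix, can
  then serve as generators.\<close>

inductive_set gen_alg :: "'x set \<Rightarrow> ('x \<Rightarrow> 'a::comm_ring_1) set \<Rightarrow> ('x \<Rightarrow> 'a) set"
  for X :: "'x set" and G :: "('x \<Rightarrow> 'a) set" where
  gen_alg_const: "(\<lambda>_. c) \<in> gen_alg X G"
| gen_alg_gen: "g \<in> G \<Longrightarrow> g \<in> gen_alg X G"
| gen_alg_add: "f \<in> gen_alg X G \<Longrightarrow> g \<in> gen_alg X G \<Longrightarrow> (\<lambda>x. f x + g x) \<in> gen_alg X G"
| gen_alg_mult: "f \<in> gen_alg X G \<Longrightarrow> g \<in> gen_alg X G \<Longrightarrow> (\<lambda>x. f x * g x) \<in> gen_alg X G"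
| gen_alg_cong: "f \<in> gen_alg X G \<Longrightarrow> (\<And>x. x \<in> X \<Longrightarrow> g x = f x) \<Longrightarrow> g \<in> gen_alg X G"

lemma gen_alg_uminus: "f \<in> gen_alg X G \<Longrightarrow> (\<lambda>x. - f x) \<in> gen_alg X G"
  using gen_alg_mult[OF gen_alg_const[of "-1"], of f] by simp

lemma gen_alg_diff:
  "f \<in> gen_alg X G \<Longrightarrow> g \<in> gen_alg X G \<Longrightarrow> (\<lambda>x. f x - g x) \<in> gen_alg X G"
  using gen_alg_add[OF _ gen_alg_uminus, of f X G g] by simp

lemma gen_alg_sum:
  assumes "\<And>i. i \<in> I \<Longrightarrow> f i \<in> gen_alg X G"
  shows "(\<lambda>x. \<Sum>i\<in>I. f i x) \<in> gen_alg X G"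
  using assms
  by (induction I rule: infinite_finite_induct) (auto intro: gen_alg_const gen_alg_add)

lemma gen_alg_prod:
  assumes "\<And>i. i \<in> I \<Longrightarrow> f i \<in> gen_alg X G"
  shows "(\<lambda>x. \<Prod>i\<in>I. f i x) \<in> gen_alg X G"
  using assms
  by (induction I rule: infinite_finite_induct) (auto intro: gen_alg_const gen_alg_mult)

lemma gen_alg_power: "f \<in> gen_alg X G \<Longrightarrow> (\<lambda>x. f x ^ k) \<in> gen_alg X G"
  by (induction k) (auto intro: gen_alg_const gen_alg_mult)

text \<open>Restriction and substitution of generators in one: regular functions of a matrix become
  polynomials in the parameters that describe a piece.\<close>

lemma gen_alg_trans:
  assumes "f \<in> gen_alg X G" "Y \<subseteq> X" "G \<subseteq> gen_alg Y H"
  shows "f \<in> gen_alg Y H"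
  using assms(1)
proof induction
  case (gen_alg_cong f g)
  then show ?case
    using assms(2) by - (rule gen_alg.gen_alg_cong[of f], auto)
qed (use assms(3) in \<open>auto intro: gen_alg.gen_alg_const gen_alg.gen_alg_add gen_alg.gen_alg_mult\<close>)

text \<open>Pullback along \<open>\<phi>\<close>; it is used for a line of parameters mapped into
  the space of matrices.\<close>

lemma gen_alg_comp:
  assumes "f \<in> gen_alg X G" "\<And>y. y \<in> Y \<Longrightarrow> \<phi> y \<in> X" "\<And>g. g \<in> G \<Longrightarrow> (\<lambda>y. g (\<phi> y)) \<in> gen_alg Y H"
  shows "(\<lambda>y. f (\<phi> y)) \<in> gen_alg Y H"
  using assms(1)
proof induction
  case (gen_alg_cong f g)
  then show ?case
    using assms(2) by - (rule gen_alg.gen_alg_cong[of "\<lambda>y. f (\<phi> y)"], auto)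
qed (use assms(3) in \<open>auto intro: gen_alg.gen_alg_const gen_alg.gen_alg_add gen_alg.gen_alg_mult\<close>)

section \<open>Monomials in a list of functions, filtered by degree\<close>

fun monom_fun :: "('x \<Rightarrow> 'a::comm_ring_1) list \<Rightarrow> nat list \<Rightarrow> 'x \<Rightarrow> 'a" where
  "monom_fun (f # fs) (m # ms) x = f x ^ m * monom_fun fs ms x"
| "monom_fun _ _ x = 1"

text \<open>Each exponent is bounded separately instead of the total degree, so that the number of
  monomials is exactly a power.\<close>

definition exps :: "nat \<Rightarrow> nat \<Rightarrow> nat list set" where
  "exps d N = {ms. set ms \<subseteq> {..N} \<and> length ms = d}"

lemma finite_exps [simp]: "finite (exps d N)"
  unfolding exps_def by (rule finite_lists_length_eq) simp

lemma card_exps: "card (exps d N) = (N + 1) ^ d"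
  unfolding exps_def by (subst card_lists_length_eq) auto

lemma exps_0 [simp]: "exps 0 N = {[]}"
  by (auto simp: exps_def)

lemma exps_mono: "N \<le> M \<Longrightarrow> exps d N \<subseteq> exps d M"
  by (auto simp: exps_def)

text \<open>Splitting off the first exponent turns a relation into a polynomial in the first
  function.\<close>

lemma sum_exps_Suc:
  "(\<Sum>ms\<in>exps (Suc d) N. h ms) = (\<Sum>m\<le>N. \<Sum>ms\<in>exps d N. h (m # ms))"
proof -
  have "exps (Suc d) N = (\<lambda>(m, ms). m # ms) ` ({..N} \<times> exps d N)"
    by (force simp: exps_def length_Suc_conv)
  moreover have "inj_on (\<lambda>(m, ms). m # ms) ({..N} \<times> exps d N)"
    by (auto simp: inj_on_def)
  ultimately show ?thesis
    by (simp add: sum.reindex case_prod_unfold sum.cartesian_product)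
qed

lemma monom_fun_in_gen_alg:
  "set fs \<subseteq> gen_alg X G \<Longrightarrow> monom_fun fs ms \<in> gen_alg X G"
  by (induction fs ms rule: list_induct2') 
    (auto intro!: gen_alg_mult gen_alg_const gen_alg_power simp: monom_fun.simps[abs_def])

text \<open>Relations are tested pointwise on \<open>X\<close>. In particular the empty list is
  independent precisely when \<open>X\<close> is non-empty, which starts the induction along a
  chain.\<close>

definition alg_indep :: "'x set \<Rightarrow> ('x \<Rightarrow> 'a::comm_ring_1) list \<Rightarrow> bool" where
  "alg_indep X fs \<longleftrightarrow>
     (\<forall>N c. (\<forall>x\<in>X. (\<Sum>ms\<in>exps (length fs) N. c ms * monom_fun fs ms x) = 0) \<longrightarrow>
        (\<forall>ms\<in>exps (length fs) N. c ms = 0))"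

text \<open>A finite-dimensional layer of the algebra generated by \<open>gs\<close>, again up to
  values off \<open>X\<close>.\<close>

definition bounded_polys :: "'x set \<Rightarrow> ('x \<Rightarrow> 'a::comm_ring_1) list \<Rightarrow> nat \<Rightarrow> ('x \<Rightarrow> 'a) set" where
  "bounded_polys X gs N =
     {f. \<exists>c. \<forall>x\<in>X. f x = (\<Sum>ms\<in>exps (length gs) N. c ms * monom_fun gs ms x)}"

lemma bounded_polys_cong:
  "f \<in> bounded_polys X gs N \<Longrightarrow> (\<And>x. x \<in> X \<Longrightarrow> g x = f x) \<Longrightarrow> g \<in> bounded_polys X gs N"
  by (auto simp: bounded_polys_def)

lemma bounded_polys_monom:
  assumes "ms \<in> exps (length gs) N"
  shows "monom_fun gs ms \<in> bounded_polys X gs N"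
proof -
  have "(\<Sum>ms'\<in>exps (length gs) N. (if ms' = ms then 1 else 0) * monom_fun gs ms' x) = monom_fun gs ms x" for x
    using assms by (simp add: if_distrib[of "\<lambda>c. c * _"] cong: if_cong)
  then show ?thesis
    unfolding bounded_polys_def by (auto intro!: exI[of _ "\<lambda>ms'. if ms' = ms then 1 else 0"])
qed

lemma bounded_polys_zero: "(\<lambda>_. 0) \<in> bounded_polys X gs N"
  unfolding bounded_polys_def by (auto intro!: exI[of _ "\<lambda>_. 0"])

lemma bounded_polys_add:
  assumes "f \<in> bounded_polys X gs N" "g \<in> bounded_polys X gs N"
  shows "(\<lambda>x. f x + g x) \<in> bounded_polys X gs N"
proof -
  obtain c d where "\<forall>x\<in>X. f x = (\<Sum>ms\<in>exps (length gs) N. c ms * monom_fun gs ms x)"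
    "\<forall>x\<in>X. g x = (\<Sum>ms\<in>exps (length gs) N. d ms * monom_fun gs ms x)"
    using assms unfolding bounded_polys_def by blast
  then show ?thesis
    unfolding bounded_polys_def
    by (auto intro!: exI[of _ "\<lambda>ms. c ms + d ms"] simp: algebra_simps sum.distrib)
qed

lemma bounded_polys_scale:
  assumes "f \<in> bounded_polys X gs N"
  shows "(\<lambda>x. a * f x) \<in> bounded_polys X gs N"
proof -
  obtain c where "\<forall>x\<in>X. f x = (\<Sum>ms\<in>exps (length gs) N. c ms * monom_fun gs ms x)"
    using assms unfolding bounded_polys_def by blast
  then show ?thesis
    unfolding bounded_polys_def
    by (auto intro!: exI[of _ "\<lambda>ms. a * c ms"] simp: sum_distrib_left mult.assoc)
qed

lemma bounded_polys_sum:
  assumes "\<And>i. i \<in> I \<Longrightarrow> f i \<in> bounded_polys X gs N"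
  shows "(\<lambda>x. \<Sum>i\<in>I. f i x) \<in> bounded_polys X gs N"
  using assms
  by (induction I rule: infinite_finite_induct) (auto intro: bounded_polys_zero bounded_polys_add)

lemma bounded_polys_mono:
  assumes "f \<in> bounded_polys X gs N" "N \<le> M"
  shows "f \<in> bounded_polys X gs M"
proof -
  obtain c where c: "\<And>x. x \<in> X \<Longrightarrow> f x = (\<Sum>ms\<in>exps (length gs) N. c ms * monom_fun gs ms x)"
    using assms unfolding bounded_polys_def by blast
  have "(\<lambda>x. \<Sum>ms\<in>exps (length gs) N. c ms * monom_fun gs ms x) \<in> bounded_polys X gs M"
    using exps_mono[OF assms(2)] by (intro bounded_polys_sum bounded_polys_scale bounded_polys_monom) auto
  then show ?thesis
    using c by (rule bounded_polys_cong)
qed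

lemma monom_fun_add:
  "length ms = length gs \<Longrightarrow> length ms' = length gs \<Longrightarrow>
     monom_fun gs (map2 (+) ms ms') x = monom_fun gs ms x * monom_fun gs ms' x"
proof (induction gs arbitrary: ms ms')
  case (Cons g gs)
  then show ?case
    by (auto simp: length_Suc_conv power_add algebra_simps)
qed simp

lemma exps_add:
  "ms \<in> exps d N \<Longrightarrow> ms' \<in> exps d M \<Longrightarrow> map2 (+) ms ms' \<in> exps d (N + M)"
  by (fastforce simp: exps_def set_zip subset_iff in_set_conv_nth intro!: add_mono)

lemma bounded_polys_mult:
  assumes "f \<in> bounded_polys X gs N" "g \<in> bounded_polys X gs M"
  shows "(\<lambda>x. f x * g x) \<in> bounded_polys X gs (N + M)"
proof -
  let ?E = "exps (length gs)"
  obtain c d where c: "\<And>x. x\<in>X \<Longrightarrow> f x = (\<Sum>ms\<in>?E N. c ms * monom_fun gs ms x)"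
    and d: "\<And>x. x\<in>X \<Longrightarrow> g x = (\<Sum>ms\<in>?E M. d ms * monom_fun gs ms x)"
    using assms unfolding bounded_polys_def by blast
  have "(\<lambda>x. \<Sum>ms\<in>?E N. \<Sum>ms'\<in>?E M. c ms * d ms' * monom_fun gs (map2 (+) ms ms') x)
      \<in> bounded_polys X gs (N + M)"
    by (intro bounded_polys_sum bounded_polys_scale bounded_polys_monom exps_add)
  then show ?thesis
  proof (rule bounded_polys_cong)
    fix x assume "x \<in> X"
    then have "f x * g x = (\<Sum>ms\<in>?E N. \<Sum>ms'\<in>?E M. c ms * d ms' * (monom_fun gs ms x * monom_fun gs ms' x))"
      by (simp add: c d sum_product algebra_simps)
    also have "\<dots> = (\<Sum>ms\<in>?E N. \<Sum>ms'\<in>?E M. c ms * d ms' * monom_fun gs (map2 (+) ms ms') x)"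
      by (intro sum.cong refl) (simp add: monom_fun_add exps_def)
    finally show "f x * g x = \<dots>" .
  qed
qed

lemma monom_fun_zero: "monom_fun gs (replicate (length gs) 0) x = 1"
  by (induction gs) auto

lemma bounded_polys_const: "(\<lambda>_. c) \<in> bounded_polys X gs N"
proof -
  have "monom_fun gs (replicate (length gs) 0) \<in> bounded_polys X gs N"
    by (rule bounded_polys_monom) (auto simp: exps_def)
  from bounded_polys_scale[OF this, of c] show ?thesis
    by (simp add: monom_fun_zero)
qed

lemma ex_monom_fun_gen:
  "g \<in> set gs \<Longrightarrow> \<exists>ms\<in>exps (length gs) 1. \<forall>x. monom_fun gs ms x = g x"
proof (induction gs)
  case (Cons h gs)
  show ?case
  proof (cases "g = h")
    case True
    then show ?thesis
      by (intro bexI[of _ "1 # replicate (length gs) 0"]) (auto simp: monom_fun_zero exps_def)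
  next
    case False
    then obtain ms where "ms \<in> exps (length gs) 1" "\<forall>x. monom_fun gs ms x = g x"
      using Cons by auto
    then show ?thesis
      by (intro bexI[of _ "0 # ms"]) (auto simp: exps_def)
  qed
qed simp

text \<open>The layers exhaust the algebra: products add the bounds, and sums are taken in the
  larger of two layers.\<close>

lemma gen_alg_imp_bounded_polys:
  assumes "f \<in> gen_alg X (set gs)"
  shows "\<exists>N. f \<in> bounded_polys X gs N"
  using assms
proof induction
  case (gen_alg_gen g)
  then obtain ms where "ms\<in>exps (length gs) 1" "\<forall>x. monom_fun gs ms x = g x"
    using ex_monom_fun_gen by blast
  then show ?case
    by (metis bounded_polys_monom bounded_polys_cong)
next
  case (gen_alg_add f g)
  then obtain N M where "f \<in> bounded_polys X gs N" "g \<in> bounded_polys X gs M"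
    by blast
  then have "f \<in> bounded_polys X gs (max N M)" "g \<in> bounded_polys X gs (max N M)"
    by (auto intro: bounded_polys_mono)
  then show ?case
    using bounded_polys_add by blast
next
  case (gen_alg_cong f g)
  then show ?case
    using bounded_polys_cong by blast
qed (auto intro: bounded_polys_const bounded_polys_mult)

lemma bounded_polys_power:
  "f \<in> bounded_polys X gs N \<Longrightarrow> (\<lambda>x. f x ^ k) \<in> bounded_polys X gs (k * N)"
  by (induction k) (auto intro: bounded_polys_const bounded_polys_mult)

text \<open>What matters is that the bound is linear in \<open>M\<close>.\<close>

lemma bounded_polys_monom_fun:
  assumes "set fs \<subseteq> bounded_polys X gs N" "ms \<in> exps (length fs) M"
  shows "monom_fun fs ms \<in> bounded_polys X gs (length fs * (M * N))"
  using assms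
proof (induction fs arbitrary: ms)
  case Nil
  then show ?case
    by (auto simp: bounded_polys_const monom_fun.simps[abs_def])
next
  case (Cons f fs)
  then obtain m ms' where ms: "ms = m # ms'" "m \<le> M" "ms' \<in> exps (length fs) M"
    by (auto simp: exps_def length_Suc_conv)
  have "(\<lambda>x. f x ^ m) \<in> bounded_polys X gs (M * N)"
    using Cons.prems ms by (auto intro!: bounded_polys_mono[OF bounded_polys_power])
  moreover have "monom_fun fs ms' \<in> bounded_polys X gs (length fs * (M * N))"
    using Cons ms by auto
  ultimately show ?case
    using bounded_polys_mult[of "\<lambda>x. f x ^ m" X gs "M * N" "monom_fun fs ms'"]
    by (simp add: ms monom_fun.simps[abs_def])
qed

text \<open>There are \<open>(N + 1) ^ e\<close> monomials of degree at most \<open>N\<close> in each of the \<open>e\<close> functions, and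
  they lie in a space of dimension \<open>O(N ^ d)\<close>.\<close>

lemma alg_indep_imp_length_le:
  fixes fs :: "('x \<Rightarrow> 'a::field) list"
  assumes "alg_indep X fs" "set fs \<subseteq> gen_alg X G" "finite G"
  shows "length fs \<le> card G"
proof (rule ccontr)
  define e d where "e = length fs" and "d = card G"
  assume "\<not> length fs \<le> card G"
  then have de: "d < e"
    by (simp add: e_def d_def)
  obtain gs where gs: "set gs = G" "length gs = d"
    using finite_distinct_list[OF assms(3)] distinct_card d_def by metis
  have "\<forall>f\<in>set fs. \<exists>N. f \<in> bounded_polys X gs N"
    using assms(2) gs gen_alg_imp_bounded_polys by blast
  then obtain D where D: "\<forall>f\<in>set fs. f \<in> bounded_polys X gs (D f)"
    using bchoice[of "set fs" "\<lambda>f N. f \<in> bounded_polys X gs N"] by blast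
  define D0 where "D0 = (\<Sum>f\<in>set fs. D f)"
  have D0: "set fs \<subseteq> bounded_polys X gs D0"
  proof
    fix f assume f: "f \<in> set fs"
    have "D f \<le> D0"
      unfolding D0_def by (rule member_le_sum) (use f in auto)
    then show "f \<in> bounded_polys X gs D0"
      using D f bounded_polys_mono by blast
  qed
  \<comment> \<open>The constants give \<open>M + 1 \<le> C * (N + 1)\<close>. As
    \<open>N = C ^ d\<close>, the dimension is at most \<open>N * (N + 1) ^ d\<close>, just below
    the number \<open>(N + 1) ^ e\<close> of monomials.\<close>
  define C where "C = e * D0 + 1"
  define N where "N = C ^ d"
  define M where "M = e * (N * D0)"
  interpret V: vector_space "\<lambda>(c::'a) (f::'x \<Rightarrow> 'a) x. c * f x"
    by unfold_locales (auto simp: algebra_simps plus_fun_def)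
  have sum_fun: "(sum h I :: 'x \<Rightarrow> 'a) = (\<lambda>x. \<Sum>i\<in>I. h i x)" for h :: "nat list \<Rightarrow> 'x \<Rightarrow> 'a" and I
    by (rule ext) (induction I rule: infinite_finite_induct, auto)
  \<comment> \<open>Cutting off outside \<open>X\<close> turns equality on \<open>X\<close> into
    equality of functions, hence into linear algebra.\<close>
  define r where "r f = (\<lambda>x. if x \<in> X then f x else 0)" for f :: "'x \<Rightarrow> 'a"
  define u where "u ms = r (monom_fun fs ms)" for ms
  define b where "b ms = r (monom_fun gs ms)" for ms
  have rel: "\<forall>ms\<in>exps e N. c ms = 0" if "(\<Sum>ms\<in>exps e N. (\<lambda>x. c ms * u ms x)) = 0" for c
  proof -
    have "(\<Sum>ms\<in>exps e N. c ms * monom_fun fs ms x) = 0" if "x \<in> X" for x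
      using fun_cong[OF \<open>(\<Sum>ms\<in>exps e N. (\<lambda>x. c ms * u ms x)) = 0\<close>, of x] that
      by (simp add: sum_fun u_def r_def)
    then show ?thesis
      using assms(1) unfolding alg_indep_def e_def by blast
  qed
  \<comment> \<open>Linear independence concerns the set of monomial functions; its size is the
    number of exponent lists only if different lists give different functions.\<close>
  have inj: "inj_on u (exps e N)"
  proof (rule inj_onI, rule ccontr)
    fix ms ms' assume ms: "ms \<in> exps e N" "ms' \<in> exps e N" "u ms = u ms'" "ms \<noteq> ms'"
    let ?c = "\<lambda>k. (if k = ms then 1 else 0) - (if k = ms' then 1 else 0 :: 'a)"
    have "(\<Sum>k\<in>exps e N. (\<lambda>x. ?c k * u k x)) = 0"
      using ms by (simp add: sum_fun left_diff_distrib sum_subtractf if_distrib[of "\<lambda>c. c * _"] 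
        fun_eq_iff cong: if_cong)
    from rel[OF this] ms show False
      by auto
  qed
  have "\<forall>ms\<in>exps e N. w (u ms) = 0" if "(\<Sum>v\<in>u ` exps e N. (\<lambda>x. w v * v x)) = 0" for w
    using that inj by (intro rel) (simp add: sum.reindex)
  then have indep: "V.independent (u ` exps e N)"
    by (subst V.dependent_finite) auto
  have "u ` exps e N \<subseteq> V.span (b ` exps d M)"
  proof safe
    fix ms assume "ms \<in> exps e N"
    then have "monom_fun fs ms \<in> bounded_polys X gs M"
      using bounded_polys_monom_fun[OF D0] by (simp add: M_def e_def)
    then obtain c where c: "\<forall>x\<in>X. monom_fun fs ms x = (\<Sum>ms\<in>exps d M. c ms * monom_fun gs ms x)"
      unfolding bounded_polys_def using gs by blast
    have "u ms = (\<Sum>k\<in>exps d M. (\<lambda>x. c k * b k x))"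
      using c by (auto simp: sum_fun u_def b_def r_def fun_eq_iff)
    also have "\<dots> \<in> V.span (b ` exps d M)"
      by (intro V.span_sum V.span_scale V.span_base) auto
    finally show "u ms \<in> V.span (b ` exps d M)" .
  qed
  from V.independent_span_bound[OF _ indep this] have "card (u ` exps e N) \<le> card (b ` exps d M)"
    by simp
  also have "\<dots> \<le> (M + 1) ^ d"
    using card_image_le[of "exps d M" b] by (simp add: card_exps)
  also have "\<dots> \<le> (C * (N + 1)) ^ d"
    by (rule power_mono) (auto simp: M_def C_def algebra_simps)
  also have "\<dots> = N * (N + 1) ^ d"
    by (simp only: N_def power_mult_distrib)
  also have "\<dots> < (N + 1) ^ Suc d"
    by simp
  also have "\<dots> \<le> (N + 1) ^ e"
    using de by (intro power_increasing) auto
  finally show False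
    using inj by (simp add: card_image card_exps)
qed

subsection \<open>Chains of irreducible closed sets\<close>

text \<open>The functions in \<open>R\<close> that vanish on \<open>Z\<close> form a prime ideal
  when \<open>R\<close> is a ring; non-emptiness of \<open>Z\<close> makes the ideal proper.\<close>

definition prime_on :: "('x \<Rightarrow> 'a::comm_ring_1) set \<Rightarrow> 'x set \<Rightarrow> bool" where
  "prime_on R Z \<longleftrightarrow> Z \<noteq> {} \<and>
     (\<forall>f\<in>R. \<forall>g\<in>R. (\<forall>x\<in>Z. f x * g x = 0) \<longrightarrow> (\<forall>x\<in>Z. f x = 0) \<or> (\<forall>x\<in>Z. g x = 0))"

lemma prime_on_cases:
  assumes "prime_on R Z" "f \<in> R" "g \<in> R" "\<forall>x\<in>Z. f x * g x = 0"
  shows "(\<forall>x\<in>Z. f x = 0) \<or> (\<forall>x\<in>Z. g x = 0)"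
  using assms unfolding prime_on_def by blast

lemma prime_onD:
  assumes "prime_on R Z" "f \<in> R" "g \<in> R" "\<And>x. x \<in> Z \<Longrightarrow> f x * g x = 0"
    "y \<in> Z" "f y \<noteq> 0" "x \<in> Z"
  shows "g x = 0"
  using assms unfolding prime_on_def by blast

lemma prime_on_prod:
  assumes "prime_on (gen_alg X G) Z" "finite I" "\<And>i. i \<in> I \<Longrightarrow> f i \<in> gen_alg X G"
    "\<And>x. x \<in> Z \<Longrightarrow> (\<Prod>i\<in>I. f i x) = 0"
  shows "\<exists>i\<in>I. \<forall>x\<in>Z. f i x = 0"
  using assms(2-)
proof (induction I rule: finite_induct)
  case empty
  then show ?case
    using assms(1) by (auto simp: prime_on_def)
next
  case (insert i I)
  have "(\<lambda>x. \<Prod>i\<in>I. f i x) \<in> gen_alg X G"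
    using insert.prems(1) by (intro gen_alg_prod) auto
  moreover have "\<forall>x\<in>Z. f i x * (\<Prod>i\<in>I. f i x) = 0"
    using insert by simp
  moreover have "f i \<in> gen_alg X G"
    using insert.prems(1) by simp
  ultimately have "(\<forall>x\<in>Z. f i x = 0) \<or> (\<forall>x\<in>Z. (\<Prod>i\<in>I. f i x) = 0)"
    using prime_on_cases[OF assms(1), of "f i" "\<lambda>x. \<Prod>i\<in>I. f i x"] by simp
  then show ?case
    using insert by auto
qed

text \<open>Adding a function that vanishes on the smaller set: in a relation on \<open>Z'\<close> the coefficient
  of the lowest power of \<open>g\<close> is a relation on \<open>Z\<close>, after cancelling that power.\<close>

lemma alg_indep_Cons:
  assumes Z: "Z \<subseteq> Z'" and prime: "prime_on (gen_alg X G) Z'"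
    and fs: "set fs \<subseteq> gen_alg X G" and g: "g \<in> gen_alg X G"
    and g0: "\<And>x. x \<in> Z \<Longrightarrow> g x = 0" and g1: "y \<in> Z'" "g y \<noteq> 0"
    and indep: "alg_indep Z fs"
  shows "alg_indep Z' (g # fs :: ('x \<Rightarrow> 'a::field) list)"
  unfolding alg_indep_def
proof (intro allI impI)
  fix N c
  let ?E = "exps (length fs) N"
  define h where "h m x = (\<Sum>ms\<in>?E. c (m # ms) * monom_fun fs ms x)" for m x
  assume "\<forall>x\<in>Z'. (\<Sum>ms\<in>exps (length (g # fs)) N. c ms * monom_fun (g # fs) ms x) = 0"
  then have rel: "(\<Sum>m\<le>N. g x ^ m * h m x) = 0" if "x \<in> Z'" for x
    using that by (simp add: sum_exps_Suc h_def sum_distrib_left mult_ac)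
  have "\<forall>ms\<in>?E. c (m # ms) = 0" if "m \<le> N" for m
    using that
  proof (induction m rule: less_induct)
    case (less m)
    \<comment> \<open>The lower coefficients vanish by induction; \<open>r\<close> is what is left
      of the relation after division by \<open>g ^ m\<close>.\<close>
    define r where "r x = (\<Sum>k\<in>{m..N}. g x ^ (k - m) * h k x)" for x
    have "h k \<in> gen_alg X G" for k
      unfolding h_def[abs_def] using fs
      by (intro gen_alg_sum gen_alg_mult gen_alg_const monom_fun_in_gen_alg)
    then have r: "r \<in> gen_alg X G"
      unfolding r_def[abs_def] using g by (intro gen_alg_sum gen_alg_mult gen_alg_power)
    have "g x ^ m * r x = 0" if "x \<in> Z'" for x
    proof -
      have "h k x = 0" if "k < m" for k
        using less that by (simp add: h_def)
      then have "(\<Sum>k\<le>N. g x ^ k * h k x) = (\<Sum>k\<in>{m..N}. g x ^ k * h k x)"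
        by (intro sum.mono_neutral_right) auto
      also have "\<dots> = g x ^ m * r x"
        unfolding r_def sum_distrib_left mult.assoc[symmetric] power_add[symmetric]
        by (intro sum.cong) auto
      finally show ?thesis
        using rel[OF that] by simp
    qed
    \<comment> \<open>Primality cancels \<open>g ^ m\<close>, which is non-zero at
      \<open>y\<close>.\<close>
    then have r0: "r x = 0" if "x \<in> Z'" for x
      using prime_onD[OF prime gen_alg_power[OF g, of m] r _ g1(1)] g1(2) that by simp
    have "h m x = 0" if "x \<in> Z" for x
    proof -
      \<comment> \<open>On \<open>Z\<close> the function \<open>g\<close> vanishes, so only the term
        with exponent 0 survives.\<close>
      have "r x = (\<Sum>k\<in>{m}. g x ^ (k - m) * h k x)"
        unfolding r_def using g0[OF that] less.prems by (intro sum.mono_neutral_right) auto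
      then show ?thesis
        using r0[of x] that Z by auto
    qed
    then have "\<forall>x\<in>Z. (\<Sum>ms\<in>?E. c (m # ms) * monom_fun fs ms x) = 0"
      by (simp add: h_def)
    with indep show ?case
      unfolding alg_indep_def by (elim allE[of _ N] allE[of _ "\<lambda>ms. c (m # ms)"]) simp
  qed
  then show "\<forall>ms\<in>exps (length (g # fs)) N. c ms = 0"
    by (auto simp: exps_def length_Suc_conv)
qed

text \<open>If there were more than \<open>d\<close> functions, each piece would carry a non-trivial
  relation between them. The product of these relations vanishes on \<open>Z\<close>, so by
  primality one of them vanishes on all of \<open>Z\<close>.\<close>

lemma alg_indep_cover_length_le:
  fixes fs :: "('x \<Rightarrow> 'a::field) list"
  assumes prime: "prime_on (gen_alg X G) Z" and indep: "alg_indep Z fs"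
    and fs: "set fs \<subseteq> gen_alg X G" and Z: "Z \<subseteq> X"
    and \<U>: "finite \<U>" "Z \<subseteq> \<Union>\<U>"
    and bound: "\<And>U. U \<in> \<U> \<Longrightarrow> \<exists>H. finite H \<and> card H \<le> d \<and> G \<subseteq> gen_alg (U \<inter> X) H"
  shows "length fs \<le> d"
proof (rule ccontr)
  assume len: "\<not> length fs \<le> d"
  let ?r = "\<lambda>N c x. \<Sum>ms\<in>exps (length fs) N. c ms * monom_fun fs ms x"
  have "\<exists>N c. (\<forall>x\<in>U \<inter> X. ?r N c x = 0) \<and> (\<exists>ms\<in>exps (length fs) N. c ms \<noteq> 0)" if U: "U \<in> \<U>" for U
  proof (rule ccontr)
    assume "\<not> ?thesis"
    then have "alg_indep (U \<inter> X) fs"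
      unfolding alg_indep_def by blast
    moreover obtain H where H: "finite H" "card H \<le> d" "G \<subseteq> gen_alg (U \<inter> X) H"
      using bound[OF U] by blast
    moreover have "set fs \<subseteq> gen_alg (U \<inter> X) H"
      using fs gen_alg_trans[OF _ _ H(3)] by blast
    ultimately show False
      using alg_indep_imp_length_le[of "U \<inter> X" fs H] len by linarith
  qed
  then obtain N c where r: "\<And>U x. U \<in> \<U> \<Longrightarrow> x \<in> U \<inter> X \<Longrightarrow> ?r (N U) (c U) x = 0"
    and c: "\<And>U. U \<in> \<U> \<Longrightarrow> \<exists>ms\<in>exps (length fs) (N U). c U ms \<noteq> 0"
    by metis
  have "\<exists>U\<in>\<U>. \<forall>x\<in>Z. ?r (N U) (c U) x = 0"
  proof (rule prime_on_prod[OF prime \<U>(1)])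
    show "(\<lambda>x. ?r (N U) (c U) x) \<in> gen_alg X G" for U
      using fs by (intro gen_alg_sum gen_alg_mult gen_alg_const monom_fun_in_gen_alg)
    show "(\<Prod>U\<in>\<U>. ?r (N U) (c U) x) = 0" if x: "x \<in> Z" for x
    proof -
      obtain U where "U \<in> \<U>" "x \<in> U"
        using x \<U>(2) by blast
      then show ?thesis
        using r[of U x] x Z \<U>(1) by (intro prod_zero) blast+
    qed
  qed
  then show False
    using indep c unfolding alg_indep_def by blast
qed

section \<open>Polynomial functions on matrices and relatively closed sets\<close>

definition mat_coords :: "nat \<Rightarrow> ('a::comm_ring_1 mat \<Rightarrow> 'a) set" where
  "mat_coords n = (\<lambda>ij A. A $$ ij) ` ({..<n} \<times> {..<n})"

abbreviation regular :: "nat \<Rightarrow> ('a::comm_ring_1 mat \<Rightarrow> 'a) set" where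
  "regular n \<equiv> gen_alg (carrier_mat n n) (mat_coords n)"

lemma eval_poly_regular:
  assumes "p \<in> mat_polys n"
  shows "eval_poly p \<in> regular n"
proof -
  have "(\<lambda>A. \<Sum>m \<in> Poly_Mapping.keys p. Poly_Mapping.lookup p m *
      (\<Prod>ij \<in> Poly_Mapping.keys m. (A $$ ij) ^ Poly_Mapping.lookup m ij)) \<in> regular n"
    using assms
    by (intro gen_alg_sum gen_alg_mult gen_alg_const gen_alg_prod gen_alg_power gen_alg_gen)
      (auto simp: mat_coords_def mat_polys_def)
  then show ?thesis
    unfolding eval_poly_def[abs_def] eval_monom_def .
qed

lemma mat_polys_add: "p \<in> mat_polys n \<Longrightarrow> q \<in> mat_polys n \<Longrightarrow> p + q \<in> mat_polys n"
  using Poly_Mapping.keys_add[of p q] unfolding mat_polys_def by blast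

lemma regular_eval_poly:
  assumes "f \<in> regular n"
  shows "\<exists>p\<in>mat_polys n. \<forall>A\<in>carrier_mat n n. f A = eval_poly p A"
  using assms
proof induction
  case (gen_alg_const c)
  have "Poly_Mapping.single 0 c \<in> mat_polys n"
    by (simp add: mat_polys_def)
  then show ?case
    by - (rule bexI[of _ "Poly_Mapping.single 0 c"], simp_all add: eval_monom_def)
next
  case (gen_alg_gen g)
  then obtain ij where ij: "ij \<in> {..<n} \<times> {..<n}" "g = (\<lambda>A. A $$ ij)"
    by (auto simp: mat_coords_def)
  have "Poly_Mapping.single (Poly_Mapping.single ij 1) 1 \<in> mat_polys n"
    using ij by (auto simp: mat_polys_def)
  then show ?case
    by - (rule bexI[of _ "Poly_Mapping.single (Poly_Mapping.single ij 1) 1"],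
      simp_all add: eval_monom_def ij(2))
next
  case (gen_alg_add f g)
  then obtain p q where "p \<in> mat_polys n" "\<forall>A\<in>carrier_mat n n. f A = eval_poly p A"
    "q \<in> mat_polys n" "\<forall>A\<in>carrier_mat n n. g A = eval_poly q A"
    by blast
  then show ?case
    by - (rule bexI[of _ "p + q"], simp_all add: eval_poly_add mat_polys_add)
next
  case (gen_alg_mult f g)
  then obtain p q where "p \<in> mat_polys n" "\<forall>A\<in>carrier_mat n n. f A = eval_poly p A"
    "q \<in> mat_polys n" "\<forall>A\<in>carrier_mat n n. g A = eval_poly q A"
    by blast
  then show ?case
    by - (rule bexI[of _ "p * q"], simp_all add: eval_poly_mult mat_polys_mult)
qed auto

text \<open>Formal polynomials and regular functions define the same zero sets, so from here on only
  functions occur.\<close>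

lemma closedin_subtopology_zariski:
  fixes Y :: "'a::idom mat set"
  assumes Y: "Y \<subseteq> carrier_mat n n"
  shows "closedin (subtopology (zariski_topology n) Y) C \<longleftrightarrow>
    (\<exists>S\<subseteq>regular n. C = {A \<in> Y. \<forall>f\<in>S. f A = 0})"
proof
  assume "closedin (subtopology (zariski_topology n) Y) C"
  then obtain S where "S \<subseteq> mat_polys n" "C = zero_locus n S \<inter> Y"
    unfolding closedin_subtopology closedin_zariski by blast
  then have "eval_poly ` S \<subseteq> regular n \<and> C = {A \<in> Y. \<forall>f\<in>eval_poly ` S. f A = 0}"
    using Y eval_poly_regular by (auto simp: zero_locus_def)
  then show "\<exists>S\<subseteq>regular n. C = {A \<in> Y. \<forall>f\<in>S. f A = 0}"
    by blast
next
  assume "\<exists>S\<subseteq>regular n. C = {A \<in> Y. \<forall>f\<in>S. f A = 0}"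
  then obtain S where S: "S \<subseteq> regular n" "C = {A \<in> Y. \<forall>f\<in>S. f A = 0}"
    by blast
  then have "\<forall>f\<in>S. \<exists>p. p \<in> mat_polys n \<and> (\<forall>A\<in>carrier_mat n n. f A = eval_poly p A)"
    using regular_eval_poly by blast
  then obtain p where p: "\<And>f. f \<in> S \<Longrightarrow> p f \<in> mat_polys n"
    "\<And>f A. f \<in> S \<Longrightarrow> A \<in> carrier_mat n n \<Longrightarrow> f A = eval_poly (p f) A"
    by metis
  have "C = zero_locus n (p ` S) \<inter> Y"
    using S(2) p(2) Y by (auto simp: zero_locus_def)
  moreover have "p ` S \<subseteq> mat_polys n"
    using p(1) by auto
  ultimately show "closedin (subtopology (zariski_topology n) Y) C"
    unfolding closedin_subtopology closedin_zariski by blast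
qed

text \<open>If \<open>f * g\<close> vanishes on \<open>Z\<close>, then \<open>Z\<close> is the union
  of its closed subsets \<open>f = 0\<close> and \<open>g = 0\<close>.\<close>

lemma irreducible_closedin_prime_on:
  fixes Y :: "'a::idom mat set"
  assumes Y: "Y \<subseteq> carrier_mat n n"
    and Z: "irreducible_closedin (subtopology (zariski_topology n) Y) Z"
  shows "prime_on (regular n) Z"
  unfolding prime_on_def
proof (intro conjI ballI impI)
  show "Z \<noteq> {}"
    using Z by (simp add: irreducible_closedin_def)
  fix f g assume fg: "f \<in> regular n" "g \<in> regular n" "\<forall>x\<in>Z. f x * g x = 0"
  obtain S where S: "S \<subseteq> regular n" "Z = {A \<in> Y. \<forall>f\<in>S. f A = 0}"
    using Z unfolding irreducible_closedin_def closedin_subtopology_zariski[OF Y] by blast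
  have cl: "closedin (subtopology (zariski_topology n) Y) {A \<in> Z. h A = 0}" if "h \<in> regular n" for h
    unfolding closedin_subtopology_zariski[OF Y]
    using S that by (intro exI[of _ "insert h S"]) auto
  have "Z = {A \<in> Z. f A = 0} \<union> {A \<in> Z. g A = 0}"
    using fg(3) by auto
  then have "Z = {A \<in> Z. f A = 0} \<or> Z = {A \<in> Z. g A = 0}"
    using Z cl[OF fg(1)] cl[OF fg(2)] unfolding irreducible_closedin_def by blast
  then show "(\<forall>x\<in>Z. f x = 0) \<or> (\<forall>x\<in>Z. g x = 0)"
    by blast
qed

text \<open>Each step up the chain contributes one of the equations of the smaller set that fails
  somewhere on the larger one, and \<open>alg_indep_Cons\<close> applies.\<close>

lemma chain_alg_indep:
  fixes Y :: "'a::field mat set"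
  assumes Y: "Y \<subseteq> carrier_mat n n"
    and "\<forall>i\<le>d. irreducible_closedin (subtopology (zariski_topology n) Y) (Z i)"
    and "\<forall>i<d. Z i \<subset> Z (Suc i)"
  shows "\<exists>fs. length fs = d \<and> set fs \<subseteq> regular n \<and> alg_indep (Z d) fs"
  using assms(2,3)
proof (induction d)
  case 0
  have "Z 0 \<noteq> {}"
    using 0 by (simp add: irreducible_closedin_def)
  then show ?case
    by (auto simp: alg_indep_def)
next
  case (Suc d)
  then obtain fs where fs: "length fs = d" "set fs \<subseteq> regular n" "alg_indep (Z d) fs"
    by auto
  have sub: "Z d \<subset> Z (Suc d)"
    using Suc by auto
  have irr: "irreducible_closedin (subtopology (zariski_topology n) Y) (Z d)"
    "irreducible_closedin (subtopology (zariski_topology n) Y) (Z (Suc d))"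
    using Suc by auto
  obtain S where S: "S \<subseteq> regular n" "Z d = {A \<in> Y. \<forall>f\<in>S. f A = 0}"
    using irr(1) unfolding irreducible_closedin_def closedin_subtopology_zariski[OF Y] by blast
  obtain y where y: "y \<in> Z (Suc d)" "y \<notin> Z d"
    using sub by blast
  moreover have "Z (Suc d) \<subseteq> Y"
    using irr(2) closedin_subset unfolding irreducible_closedin_def by fastforce
  ultimately obtain g where g: "g \<in> S" "g y \<noteq> 0"
    using S(2) by blast
  have "alg_indep (Z (Suc d)) (g # fs)"
    using sub fs g y S irreducible_closedin_prime_on[OF Y irr(2)]
    by (intro alg_indep_Cons[of "Z d" _ "carrier_mat n n" "mat_coords n" fs g y]) auto
  then show ?case
    using fs g S by (intro exI[of _ "g # fs"]) auto
qed

text \<open>A chain gives as many independent functions as it has steps, and the covering argument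
  bounds their number. The members of \<open>H\<close> may be arbitrary functions on the
  piece.\<close>

proposition krull_dim_le:
  fixes Y :: "'a::field mat set"
  assumes Y: "Y \<subseteq> carrier_mat n n" and \<U>: "finite \<U>" "Y \<subseteq> \<Union>\<U>"
    and bound: "\<And>U. U \<in> \<U> \<Longrightarrow>
      \<exists>H. finite H \<and> card H \<le> d \<and> mat_coords n \<subseteq> gen_alg (U \<inter> carrier_mat n n) H"
  shows "krull_dim (subtopology (zariski_topology n) Y) \<le> ereal (real d)"
  unfolding krull_dim_def
proof (rule SUP_least, clarify)
  fix e Z
  assume Z: "\<forall>i\<le>e. irreducible_closedin (subtopology (zariski_topology n) Y) (Z i)"
    "\<forall>i<e. Z i \<subset> Z (Suc i)"
  obtain fs where fs: "length fs = e" "set fs \<subseteq> regular n" "alg_indep (Z e) fs"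
    using chain_alg_indep[OF Y Z] by blast
  have irr: "irreducible_closedin (subtopology (zariski_topology n) Y) (Z e)"
    using Z by blast
  have ZY: "Z e \<subseteq> Y"
    using irr closedin_subset unfolding irreducible_closedin_def by fastforce
  then have "length fs \<le> d"
    using alg_indep_cover_length_le[OF irreducible_closedin_prime_on[OF Y irr] fs(3,2) _ \<U>(1) _ bound]
      Y \<U>(2) by blast
  then show "ereal (real e) \<le> ereal (real d)"
    using fs(1) by simp
qed

text \<open>The sets \<open>\<Phi> i\<close> are meant to be images of parametrisations. Their
  closures in \<open>Y\<close> form the chain: they satisfy the same equations, hence inherit
  primality, and the separating functions still separate.\<close>

proposition krull_dim_ge:
  fixes Y :: "'a::field mat set"
  assumes Y: "Y \<subseteq> carrier_mat n n"
    and \<Phi>: "\<And>i. i \<le> d \<Longrightarrow> \<Phi> i \<subseteq> Y" "\<And>i. i \<le> d \<Longrightarrow> prime_on (regular n) (\<Phi> i)"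
    and step: "\<And>i. i < d \<Longrightarrow> \<Phi> i \<subseteq> \<Phi> (Suc i)"
      "\<And>i. i < d \<Longrightarrow> \<exists>f\<in>regular n. (\<forall>A\<in>\<Phi> i. f A = 0) \<and> (\<exists>A\<in>\<Phi> (Suc i). f A \<noteq> 0)"
  shows "ereal (real d) \<le> krull_dim (subtopology (zariski_topology n) Y)"
  unfolding krull_dim_def
proof (rule SUP_upper, safe)
  \<comment> \<open>\<open>I i\<close> is the vanishing ideal of \<open>\<Phi> i\<close>, and
    \<open>Z i\<close> is the closure of \<open>\<Phi> i\<close> in \<open>Y\<close>.\<close>
  define I where "I i = {f \<in> regular n. \<forall>A\<in>\<Phi> i. f A = 0}" for i
  define Z where "Z i = {A \<in> Y. \<forall>f\<in>I i. f A = 0}" for i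
  have \<Phi>Z: "\<Phi> i \<subseteq> Z i" if "i \<le> d" for i
    using \<Phi>(1)[OF that] by (auto simp: Z_def I_def)
  have irr: "irreducible_closedin (subtopology (zariski_topology n) Y) (Z i)" if i: "i \<le> d" for i
    unfolding irreducible_closedin_def
  proof (intro conjI allI impI)
    show "closedin (subtopology (zariski_topology n) Y) (Z i)"
      unfolding closedin_subtopology_zariski[OF Y] Z_def by (intro exI[of _ "I i"]) (auto simp: I_def)
    show "Z i \<noteq> {}"
      using \<Phi>Z[OF i] \<Phi>(2)[OF i] by (auto simp: prime_on_def)
    fix A B
    assume AB: "closedin (subtopology (zariski_topology n) Y) A \<and>
      closedin (subtopology (zariski_topology n) Y) B \<and> Z i = A \<union> B"
    then obtain S T where S: "S \<subseteq> regular n" "A = {A \<in> Y. \<forall>f\<in>S. f A = 0}"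
      and T: "T \<subseteq> regular n" "B = {A \<in> Y. \<forall>f\<in>T. f A = 0}"
      unfolding closedin_subtopology_zariski[OF Y] by blast
    show "Z i = A \<or> Z i = B"
    \<comment> \<open>If neither family of equations holds on \<open>\<Phi> i\<close>, one failing
      equation from each has a product vanishing on \<open>\<Phi> i\<close>, against
      primality.\<close>
    proof (cases "S \<subseteq> I i \<or> T \<subseteq> I i")
      case True
      then have "Z i \<subseteq> A \<or> Z i \<subseteq> B"
        using S T by (auto simp: Z_def)
      then show ?thesis
        using AB by blast
    next
      case False
      then obtain f g where fg: "f \<in> S" "f \<notin> I i" "g \<in> T" "g \<notin> I i"
        by blast
      have "\<forall>x\<in>\<Phi> i. f x * g x = 0"
        using \<Phi>Z[OF i] AB S T fg by auto
      then have "(\<forall>x\<in>\<Phi> i. f x = 0) \<or> (\<forall>x\<in>\<Phi> i. g x = 0)"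
        using \<Phi>(2)[OF i] fg S T unfolding prime_on_def by blast
      then show ?thesis
        using fg S T by (auto simp: I_def)
    qed
  qed
  have "Z i \<subset> Z (Suc i)" if i: "i < d" for i
  proof
    show "Z i \<subseteq> Z (Suc i)"
      using step(1)[OF i] by (auto simp: Z_def I_def)
    obtain f A where "f \<in> regular n" "\<forall>A\<in>\<Phi> i. f A = 0" "A \<in> \<Phi> (Suc i)" "f A \<noteq> 0"
      using step(2)[OF i] by blast
    then have "A \<in> Z (Suc i)" "A \<notin> Z i"
      using \<Phi>Z[of "Suc i"] i by (auto simp: Z_def I_def)
    then show "Z i \<noteq> Z (Suc i)"
      by blast
  qed
  with irr show "\<exists>Z. (\<forall>i\<le>d. irreducible_closedin (subtopology (zariski_topology n) Y) (Z i)) \<and>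
      (\<forall>i<d. Z i \<subset> Z (Suc i))"
    by blast
qed

subsection \<open>Matrices of corank two\<close>

text \<open>Rank-nullity for multiplication by \<open>A\<close>, whose image is the column
  span.\<close>

lemma rank_plus_kernel_dim:
  fixes A :: "'a::field mat"
  assumes A: "A \<in> carrier_mat nr nc"
  shows "vec_space.rank nr A + kernel.dim nc A = nc"
proof -
  interpret V: vec_space "TYPE('a)" nc .
  interpret W: vec_space "TYPE('a)" nr .
  interpret L: linear_map class_ring V.V W.V "\<lambda>v. A *\<^sub>v v"
    using A by unfold_locales
      (auto simp: module_hom_def module_vec_simps mult_add_distrib_mat_vec mult_mat_vec)
  have im: "L.imT = W.span (set (cols A))"
    using W.col_space_eq[OF A] A by (auto simp: L.im_def W.col_space_def)
  have ker: "L.kerT = mat_kernel A"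
    using A by (auto simp: L.ker_def mat_kernel)
  show ?thesis
    using L.rank_nullity[OF V.fin_dim] unfolding im ker W.rank_def V.dim_is_n .
qed

text \<open>Vectors are plain functions of which only the entries below \<open>n\<close> count; this
  avoids dimension side conditions.\<close>

definition in_ker :: "nat \<Rightarrow> 'a::comm_ring_1 mat \<Rightarrow> (nat \<Rightarrow> 'a) \<Rightarrow> bool" where
  "in_ker n A v \<longleftrightarrow> (\<forall>i<n. (\<Sum>j<n. A $$ (i, j) * v j) = 0)"

lemma in_ker_lincomb:
  assumes "in_ker n A u" "in_ker n A w"
  shows "in_ker n A (\<lambda>j. a * u j + b * w j)"
proof -
  have "(\<Sum>j<n. A $$ (i, j) * (a * u j + b * w j)) =
      a * (\<Sum>j<n. A $$ (i, j) * u j) + b * (\<Sum>j<n. A $$ (i, j) * w j)" for i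
    by (simp add: algebra_simps sum.distrib sum_distrib_left)
  then show ?thesis
    using assms by (simp add: in_ker_def)
qed

lemma vec_in_mat_kernel_iff:
  assumes "A \<in> carrier_mat n n"
  shows "v \<in> mat_kernel A \<longleftrightarrow> v \<in> carrier_vec n \<and> in_ker n A (\<lambda>j. v $ j)"
proof -
  have "A *\<^sub>v v = 0\<^sub>v n \<longleftrightarrow> in_ker n A (\<lambda>j. v $ j)" if "v \<in> carrier_vec n"
    using assms that
    by (auto simp: in_ker_def vec_eq_iff scalar_prod_def lessThan_atLeast0)
  then show ?thesis
    using mat_kernel[OF assms] by auto
qed

lemma in_ker_cong: "(\<And>j. j < n \<Longrightarrow> v j = w j) \<Longrightarrow> in_ker n A v \<longleftrightarrow> in_ker n A w"
  by (simp add: in_ker_def)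

text \<open>The identity block at the positions \<open>a, b\<close> removes the freedom of a base
  change and makes the two vectors independent.\<close>

definition ker_pair :: "nat \<Rightarrow> 'a::comm_ring_1 mat \<Rightarrow> nat \<Rightarrow> nat \<Rightarrow> (nat \<Rightarrow> 'a) \<Rightarrow> (nat \<Rightarrow> 'a) \<Rightarrow> bool" where
  "ker_pair n A a b x y \<longleftrightarrow> a < n \<and> b < n \<and> a \<noteq> b \<and> in_ker n A x \<and> in_ker n A y \<and>
     x a = 1 \<and> x b = 0 \<and> y a = 0 \<and> y b = 1"

definition spans_ker :: "nat \<Rightarrow> 'a::comm_ring_1 mat \<Rightarrow> (nat \<Rightarrow> 'a) \<Rightarrow> (nat \<Rightarrow> 'a) \<Rightarrow> bool" where
  "spans_ker n A p q \<longleftrightarrow> (\<forall>v. in_ker n A v \<longrightarrow> (\<exists>\<alpha> \<beta>. \<forall>j<n. v j = \<alpha> * p j + \<beta> * q j))"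

text \<open>Over a field it vanishes exactly when the plane vectors with entries
  \<open>x i, y i\<close> and \<open>x j, y j\<close> are linearly dependent.\<close>

definition minor2 :: "(nat \<Rightarrow> 'a::comm_ring_1) \<Rightarrow> (nat \<Rightarrow> 'a) \<Rightarrow> nat \<Rightarrow> nat \<Rightarrow> 'a" where
  "minor2 x y i j = x i * y j - x j * y i"

text \<open>Multiplication by the inverse of the block at \<open>a, b\<close>. The last two
  equations undo the change of basis, so that spanning carries over.\<close>

lemma ker_pair_normalize:
  fixes A :: "'a::field mat"
  assumes "in_ker n A u" "in_ker n A w" "a < n" "b < n" "minor2 u w a b \<noteq> 0"
  defines "x \<equiv> \<lambda>j. w b / minor2 u w a b * u j + (- u b / minor2 u w a b) * w j"
    and "y \<equiv> \<lambda>j. - w a / minor2 u w a b * u j + u a / minor2 u w a b * w j"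
  shows "ker_pair n A a b x y" "u j = u a * x j + u b * y j" "w j = w a * x j + w b * y j"
proof -
  let ?D = "minor2 u w a b"
  have "in_ker n A x" "in_ker n A y"
    unfolding x_def y_def by (intro in_ker_lincomb assms)+
  moreover have "a \<noteq> b"
    using assms by (auto simp: minor2_def)
  moreover have xy: "x j = (w b * u j - u b * w j) / ?D" "y j = (u a * w j - w a * u j) / ?D" for j
    by (simp_all add: x_def y_def diff_divide_distrib)
  moreover have "x a = ?D / ?D" "y b = ?D / ?D"
    unfolding xy by (simp_all add: minor2_def mult.commute)
  moreover have "x b = 0" "y a = 0"
    by (simp_all add: x_def y_def)
  ultimately show "ker_pair n A a b x y"
    using assms by (simp add: ker_pair_def)
  have "(u a * x j + u b * y j) * ?D = u j * ?D"
    using assms(5) unfolding xy by (simp add: field_simps) (simp add: minor2_def algebra_simps)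
  then show "u j = u a * x j + u b * y j"
    using assms(5) by simp
  have "(w a * x j + w b * y j) * ?D = w j * ?D"
    using assms(5) unfolding xy by (simp add: field_simps) (simp add: minor2_def algebra_simps)
  then show "w j = w a * x j + w b * y j"
    using assms(5) by simp
qed

lemma spans_ker_change:
  assumes "spans_ker n A u w" "\<And>j. u j = a * x j + b * y j" "\<And>j. w j = c * x j + d * y j"
  shows "spans_ker n A x y"
  unfolding spans_ker_def
proof (intro allI impI)
  fix v assume "in_ker n A v"
  then obtain \<alpha> \<beta> where "\<forall>j<n. v j = \<alpha> * u j + \<beta> * w j"
    using assms(1) unfolding spans_ker_def by blast
  then show "\<exists>\<alpha> \<beta>. \<forall>j<n. v j = \<alpha> * x j + \<beta> * y j"
    using assms(2,3)
    by (intro exI[of _ "\<alpha> * a + \<beta> * c"] exI[of _ "\<alpha> * b + \<beta> * d"]) (simp add: algebra_simps)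
qed

text \<open>A basis of the kernel has two elements; being independent they have a non-zero 2 by 2
  minor, at which they are normalised.\<close>

lemma corank_two_ker_pair:
  fixes A :: "'a::field mat"
  assumes A: "A \<in> carrier_mat n n" and rank: "vec_space.rank n A + 2 = n"
  shows "\<exists>c d p q. ker_pair n A c d p q \<and> spans_ker n A p q"
proof -
  interpret K: kernel n n A
    using A by unfold_locales
  have dim: "K.dim = 2"
    using rank_plus_kernel_dim[OF A] rank by simp
  obtain B where B: "finite B" "K.basis B"
    using kernel_basis_exists[OF A] by blast
  then have "card B = 2"
    using dim K.Ker.dim_basis by simp
  then obtain u w where uw: "B = {u, w}" "u \<noteq> w"
    by (auto simp: card_2_iff)
  have Bk: "B \<subseteq> mat_kernel A" and indep: "\<not> K.NC.lin_dep B" and span: "K.NC.span B = mat_kernel A"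
    using B K.lindep_same[of B] K.span_same[of B] by (auto simp: K.Ker.basis_def)
  have Bc: "B \<subseteq> carrier_vec n"
    using Bk mat_kernel_carrier[OF A] by blast
  have ker: "in_ker n A (\<lambda>j. u $ j)" "in_ker n A (\<lambda>j. w $ j)"
    using Bk uw vec_in_mat_kernel_iff[OF A] by auto
  have lc: "K.NC.lincomb f B $ j = f u * u $ j + f w * w $ j" if "j < n" for f j
    using K.NC.lincomb_index[OF that Bc, of f] uw by simp
  have spans: "spans_ker n A (\<lambda>j. u $ j) (\<lambda>j. w $ j)"
    unfolding spans_ker_def
  proof (intro allI impI)
    fix v assume "in_ker n A v"
    then have "in_ker n A (\<lambda>j. vec n v $ j)"
      by (simp add: in_ker_cong[of n "\<lambda>j. vec n v $ j" v])
    then have "vec n v \<in> K.NC.span B"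
      unfolding span vec_in_mat_kernel_iff[OF A] by simp
    then obtain f where "vec n v = K.NC.lincomb f B"
      using K.NC.finite_span[OF B(1) Bc] by auto
    then have "v j = f u * u $ j + f w * w $ j" if "j < n" for j
      using lc[OF that, of f] that by (metis index_vec)
    then show "\<exists>\<alpha> \<beta>. \<forall>j<n. v j = \<alpha> * u $ j + \<beta> * w $ j"
      by blast
  qed
  have dep: "f u = 0 \<and> f w = 0" if "\<And>j. j < n \<Longrightarrow> f u * u $ j + f w * w $ j = 0" for f
  proof (rule ccontr)
    assume "\<not> (f u = 0 \<and> f w = 0)"
    moreover have "K.NC.lincomb f B = 0\<^sub>v n"
      using that lc K.NC.lincomb_dim[OF B(1) Bc] by (intro eq_vecI) auto
    ultimately have "K.NC.lin_dep B"
      unfolding K.NC.lin_dep_def using B(1) uw by (auto intro!: exI[of _ B] exI[of _ f])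
    then show False
      using indep by simp
  qed
  have "\<exists>c d. c < n \<and> d < n \<and> minor2 (\<lambda>j. u $ j) (\<lambda>j. w $ j) c d \<noteq> 0"
  proof (rule ccontr)
    assume neg: "\<not> ?thesis"
    obtain c where c: "c < n" "u $ c \<noteq> 0"
      using dep[of "\<lambda>b. if b = u then 1 else 0"] uw(2) by auto
    \<comment> \<open>If all minors vanish, the coefficients \<open>- w $ c\<close> and
      \<open>u $ c\<close> give a linear relation between \<open>u\<close> and
      \<open>w\<close>.\<close>
    have "u $ c = 0"
      using dep[of "\<lambda>b. if b = u then - w $ c else u $ c"] neg c(1) uw(2)
      by (auto simp: minor2_def algebra_simps)
    with c show False
      by simp
  qed
  then obtain c d where "c < n" "d < n" "minor2 (\<lambda>j. u $ j) (\<lambda>j. w $ j) c d \<noteq> 0"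
    by blast
  note norm = ker_pair_normalize[OF ker this]
  from norm(1) spans_ker_change[OF spans norm(2,3)] show ?thesis
    by blast
qed

text \<open>The identity block makes the pair independent, so it is a basis of the kernel. This
  serves to compute the rank of the explicit family.\<close>

lemma rank_if_ker_pair:
  fixes A :: "'a::field mat"
  assumes A: "A \<in> carrier_mat n n" and pq: "ker_pair n A c d p q" "spans_ker n A p q"
  shows "vec_space.rank n A + 2 = n"
proof -
  interpret K: kernel n n A
    using A by unfold_locales
  define P Q where "P = vec n p" and "Q = vec n q"
  have cd: "c < n" "d < n" "p c = 1" "p d = 0" "q c = 0" "q d = 1"
    using pq(1) by (auto simp: ker_pair_def)
  have "P $ c = 1" "Q $ c = 0"
    using cd by (simp_all add: P_def Q_def)
  then have PQ: "P \<noteq> Q"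
    by auto
  have Pk: "P \<in> mat_kernel A" "Q \<in> mat_kernel A"
    using pq(1) in_ker_cong[of n "\<lambda>j. vec n p $ j" p] in_ker_cong[of n "\<lambda>j. vec n q $ j" q]
    by (auto simp: vec_in_mat_kernel_iff[OF A] P_def Q_def ker_pair_def)
  have Pc: "{P, Q} \<subseteq> carrier_vec n"
    by (simp add: P_def Q_def)
  have lc: "K.NC.lincomb f {P, Q} $ j = f P * p j + f Q * q j" if "j < n" for f j
    using K.NC.lincomb_index[OF that Pc, of f] PQ that by (simp add: P_def Q_def)
  have "\<not> K.NC.lin_dep {P, Q}"
  proof
    assume "K.NC.lin_dep {P, Q}"
    then obtain f v where f: "K.NC.lincomb f {P, Q} = 0\<^sub>v n" "v \<in> {P, Q}" "f v \<noteq> 0"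
      using K.NC.finite_lin_dep[of "{P, Q}"] Pc by auto
    have "f P = 0" "f Q = 0"
      using lc[of c f] lc[of d f] f(1) cd by auto
    then show False
      using f by auto
  qed
  moreover have "mat_kernel A \<subseteq> K.NC.span {P, Q}"
  proof
    fix v assume v: "v \<in> mat_kernel A"
    then have vc: "v \<in> carrier_vec n" "in_ker n A (\<lambda>j. v $ j)"
      using vec_in_mat_kernel_iff[OF A] by auto
    then obtain \<alpha> \<beta> where ab: "\<forall>j<n. v $ j = \<alpha> * p j + \<beta> * q j"
      using pq(2) unfolding spans_ker_def by blast
    let ?f = "\<lambda>b. if b = P then \<alpha> else \<beta>"
    have "v = K.NC.lincomb ?f {P, Q}"
      using vc ab lc[of _ ?f] PQ K.NC.lincomb_dim[OF _ Pc, of ?f] by (intro eq_vecI) auto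
    then show "v \<in> K.NC.span {P, Q}"
      by (rule K.NC.in_spanI) auto
  qed
  ultimately have "K.basis {P, Q}"
    using Pk K.lindep_same[of "{P, Q}"] K.span_same[of "{P, Q}"] K.Ker.span_is_subset2[of "{P, Q}"]
    by (auto simp: K.Ker.basis_def)
  then have "K.dim = card {P, Q}"
    using K.Ker.dim_basis[of "{P, Q}"] by simp
  then show ?thesis
    using rank_plus_kernel_dim[OF A] PQ by simp
qed

lemma ex_in_ker_if_det_0:
  fixes A :: "'a::field mat"
  assumes A: "A \<in> carrier_mat n n" "det A = 0"
  shows "\<exists>v. in_ker n A v \<and> (\<exists>j<n. v j \<noteq> 0)"
proof -
  obtain v where v: "v \<in> carrier_vec n" "v \<noteq> 0\<^sub>v n" "A *\<^sub>v v = 0\<^sub>v n"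
    using det_0_iff_vec_prod_zero_field[OF A(1)] A(2) by blast
  then have "in_ker n A (\<lambda>j. v $ j)"
    using vec_in_mat_kernel_iff[OF A(1)] mat_kernel[OF A(1)] by blast
  moreover have "\<exists>j<n. v $ j \<noteq> 0"
    using v by (metis carrier_vecD dim_vec eq_vecI index_zero_vec zero_vec_def)
  ultimately show ?thesis
    by blast
qed

text \<open>A homogeneous system with fewer equations than unknowns has a non-trivial solution; the
  zero row stands for the missing equation.\<close>

lemma ex_in_ker_if_zero_row:
  fixes f :: "nat \<Rightarrow> nat \<Rightarrow> 'a::field"
  assumes "c < n" "\<And>j. f c j = 0"
  shows "\<exists>v. (\<forall>i<n. (\<Sum>j<n. f i j * v j) = 0) \<and> (\<exists>j<n. v j \<noteq> 0)"
proof -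
  define C where "C = mat n n (\<lambda>(i, j). f i j)"
  have C: "C \<in> carrier_mat n n"
    by (simp add: C_def)
  have "C = mat\<^sub>r n n (\<lambda>i. if i = c then 0\<^sub>v n else row C i)"
    using assms by (intro eq_rowI) (auto simp: C_def)
  moreover have "row C \<in> {0..<n} \<rightarrow> carrier_vec n"
    using C by auto
  ultimately have "det C = 0"
    using det_row_0[OF assms(1), of "row C"] by simp
  from ex_in_ker_if_det_0[OF C this] obtain v where "in_ker n C v" "\<exists>j<n. v j \<noteq> 0"
    by blast
  then show ?thesis
    by (auto simp: in_ker_def C_def)
qed

text \<open>Because of the column relations \<open>p, q\<close>, a left kernel vector has to satisfy
  only the \<open>n - 2\<close> equations of the columns other than \<open>c, d\<close>. This leaves
  room for a solution \<open>x\<close>, and for a second one with the extra condition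
  \<open>y a = 0\<close>.\<close>

lemma corank_two_left_ker:
  fixes A :: "'a::field mat"
  assumes A: "A \<in> carrier_mat n n" and pq: "ker_pair n A c d p q"
  shows "\<exists>a b x y. ker_pair n (transpose_mat A) a b x y"
proof -
  have cd: "c < n" "d < n" "c \<noteq> d" "p c = 1" "p d = 0" "q c = 0" "q d = 1" "in_ker n A p" "in_ker n A q"
    using pq by (auto simp: ker_pair_def)
  \<comment> \<open>The vector \<open>s\<close> of column sums weighted by \<open>x\<close> is
    orthogonal to the kernel and supported on \<open>c, d\<close>; testing it against
    \<open>p\<close> and \<open>q\<close> shows that it is zero.\<close>
  have ker: "in_ker n (transpose_mat A) x"
    if x: "\<And>i. i < n \<Longrightarrow> i \<noteq> c \<Longrightarrow> i \<noteq> d \<Longrightarrow> (\<Sum>j<n. A $$ (j, i) * x j) = 0" for x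
  proof -
    define s where "s i = (\<Sum>j<n. A $$ (j, i) * x j)" for i
    have *: "(\<Sum>i<n. s i * v i) = 0" if "in_ker n A v" for v
    proof -
      have "(\<Sum>i<n. s i * v i) = (\<Sum>i<n. \<Sum>j<n. A $$ (j, i) * x j * v i)"
        by (simp add: s_def sum_distrib_right)
      also have "\<dots> = (\<Sum>j<n. x j * (\<Sum>i<n. A $$ (j, i) * v i))"
        by (subst sum.swap) (simp add: sum_distrib_left mult_ac)
      also have "\<dots> = 0"
        using that by (simp add: in_ker_def)
      finally show ?thesis .
    qed
    have sum2: "(\<Sum>i<n. s i * v i) = s c * v c + s d * v d" for v
    proof -
      have "(\<Sum>i<n. s i * v i) = (\<Sum>i\<in>{c, d}. s i * v i)"
        using x cd by (intro sum.mono_neutral_right) (auto simp: s_def)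
      then show ?thesis
        using cd by simp
    qed
    have "s c = 0" "s d = 0"
      using *[OF cd(8)] *[OF cd(9)] sum2[of p] sum2[of q] cd by auto
    then have "s i = 0" if "i < n" for i
      using x[OF that] by (cases "i = c"; cases "i = d") (auto simp: s_def)
    then show ?thesis
      using A by (simp add: in_ker_def s_def)
  qed
  obtain x where x: "\<forall>i<n. (\<Sum>j<n. (if i = c \<or> i = d then 0 else A $$ (j, i)) * x j) = 0" "\<exists>j<n. x j \<noteq> 0"
    using ex_in_ker_if_zero_row[OF cd(1), of "\<lambda>i j. if i = c \<or> i = d then 0 else A $$ (j, i)"] by auto
  then obtain a where a: "a < n" "x a \<noteq> 0"
    by blast
  \<comment> \<open>Equation \<open>c\<close> stays empty, while equation \<open>d\<close> is
    replaced by \<open>y a = 0\<close>.\<close>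
  obtain y where y: "\<forall>i<n. (\<Sum>j<n. (if i = c then 0 else if i = d then (if j = a then 1 else 0) else A $$ (j, i)) * y j) = 0"
    "\<exists>j<n. y j \<noteq> 0"
    using ex_in_ker_if_zero_row[OF cd(1), of "\<lambda>i j. if i = c then 0 else if i = d then (if j = a then 1 else 0) else A $$ (j, i)"]
    by auto
  then obtain b where b: "b < n" "y b \<noteq> 0"
    by blast
  have "(\<Sum>j<n. (if j = a then 1 else 0) * y j) = 0"
    using y(1)[rule_format, of d] cd by simp
  then have ya: "y a = 0"
    using a by (simp add: if_distrib[of "\<lambda>c. c * _"] cong: if_cong)
  have "in_ker n (transpose_mat A) x" 
  proof (rule ker)
    show "(\<Sum>j<n. A $$ (j, i) * x j) = 0" if "i < n" "i \<noteq> c" "i \<noteq> d" for i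
      using x(1)[rule_format, of i] that by simp
  qed
  moreover have "in_ker n (transpose_mat A) y"
  proof (rule ker)
    show "(\<Sum>j<n. A $$ (j, i) * y j) = 0" if "i < n" "i \<noteq> c" "i \<noteq> d" for i
      using y(1)[rule_format, of i] that by simp
  qed
  moreover have "minor2 x y a b \<noteq> 0"
    using a b ya by (simp add: minor2_def)
  ultimately show ?thesis
    using ker_pair_normalize(1)[OF _ _ a(1) b(1)] by blast
qed

text \<open>The determinant criterion, transported along the bijection \<open>pick I\<close> so that
  rows and columns keep their original indices.\<close>

lemma principal_minor_eq_0_iff:
  fixes A :: "'a::field mat"
  assumes A: "A \<in> carrier_mat n n" and I: "I \<subseteq> {..<n}"
  shows "principal_minor A I = 0 \<longleftrightarrow>
    (\<exists>v. (\<forall>i\<in>I. (\<Sum>j\<in>I. A $$ (i, j) * v j) = 0) \<and> (\<exists>j\<in>I. v j \<noteq> 0))"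
proof -
  define k where "k = card I"
  have fin: "finite I"
    using I finite_subset by blast
  have II: "{i. i < n \<and> i \<in> I} = I"
    using I by auto
  have S: "submatrix A I I \<in> carrier_mat k k"
    using A II by (auto simp: submatrix_def k_def)
  have bij: "bij_betw (pick I) {..<k} I"
    unfolding bij_betw_def
  proof
    show inj: "inj_on (pick I) {..<k}"
      by (rule linorder_inj_onI) (use pick_mono[of _ I] in \<open>force simp: k_def\<close>)+
    have "pick I ` {..<k} \<subseteq> I"
      using pick_in_set by (auto simp: k_def)
    then show "pick I ` {..<k} = I"
      using inj fin by (intro card_subset_eq) (auto simp: card_image k_def)
  qed
  have idx: "submatrix A I I $$ (i, j) = A $$ (pick I i, pick I j)" if "i < k" "j < k" for i j
    using that A II by (intro submatrix_index) (auto simp: k_def)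
  have sum: "(\<Sum>j<k. h (pick I j)) = (\<Sum>j\<in>I. h j)" for h :: "nat \<Rightarrow> 'a"
    using sum.reindex_bij_betw[OF bij] .
  have all: "(\<forall>i<k. P (pick I i)) \<longleftrightarrow> (\<forall>i\<in>I. P i)" and ex: "(\<exists>i<k. P (pick I i)) \<longleftrightarrow> (\<exists>i\<in>I. P i)" for P
    using bij unfolding bij_betw_def by force+
  have eq: "(\<Sum>j<k. submatrix A I I $$ (i, j) * v (pick I j)) = (\<Sum>j\<in>I. A $$ (pick I i, j) * v j)" if "i < k" for i v
    using that sum[of "\<lambda>j. A $$ (pick I i, j) * v j"] idx by simp
  have ker: "in_ker k (submatrix A I I) (\<lambda>j. v (pick I j)) \<longleftrightarrow> (\<forall>i\<in>I. (\<Sum>j\<in>I. A $$ (i, j) * v j) = 0)" for v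
    unfolding in_ker_def all[of "\<lambda>i. (\<Sum>j\<in>I. A $$ (i, j) * v j) = 0", symmetric] using eq by simp
  show ?thesis
  proof
    assume "principal_minor A I = 0"
    then obtain v where v: "in_ker k (submatrix A I I) v" "\<exists>j<k. v j \<noteq> 0"
      using ex_in_ker_if_det_0[OF S] unfolding principal_minor_def by blast
    define w where "w i = v (the_inv_into {..<k} (pick I) i)" for i
    have wv: "w (pick I j) = v j" if "j < k" for j
      using that bij by (simp add: w_def bij_betw_def the_inv_into_f_f)
    have "in_ker k (submatrix A I I) (\<lambda>j. w (pick I j))"
      using v(1) in_ker_cong[of k "\<lambda>j. w (pick I j)" v, OF wv] by simp
    moreover have "\<exists>j\<in>I. w j \<noteq> 0"
      using v(2) wv unfolding ex[of "\<lambda>j. w j \<noteq> 0", symmetric] by auto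
    ultimately show "\<exists>v. (\<forall>i\<in>I. (\<Sum>j\<in>I. A $$ (i, j) * v j) = 0) \<and> (\<exists>j\<in>I. v j \<noteq> 0)"
      using ker by blast
  next
    assume "\<exists>v. (\<forall>i\<in>I. (\<Sum>j\<in>I. A $$ (i, j) * v j) = 0) \<and> (\<exists>j\<in>I. v j \<noteq> 0)"
    then obtain v where "\<forall>i\<in>I. (\<Sum>j\<in>I. A $$ (i, j) * v j) = 0" "\<exists>j\<in>I. v j \<noteq> 0"
      by blast
    then have v: "in_ker k (submatrix A I I) (\<lambda>j. v (pick I j))" "\<exists>j<k. v (pick I j) \<noteq> 0"
      unfolding ker ex[of "\<lambda>j. v j \<noteq> 0"] by blast+
    define w where "w = vec k (\<lambda>j. v (pick I j))"
    have "w \<in> mat_kernel (submatrix A I I)"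
      using v(1) unfolding vec_in_mat_kernel_iff[OF S] w_def in_ker_def by simp
    moreover have "w \<noteq> 0\<^sub>v k"
      using v(2) by (auto simp: w_def vec_eq_iff)
    ultimately show "principal_minor A I = 0"
      unfolding principal_minor_def det_0_iff_vec_prod_zero_field[OF S] mat_kernel[OF S] by blast
  qed
qed

subsection \<open>The upper bound\<close>

text \<open>Extend a kernel vector of the submatrix by zero to \<open>w\<close>. Then
  \<open>A w\<close> is supported on \<open>i, j\<close> and orthogonal to the left kernel, hence
  zero. So \<open>w\<close> is a combination of \<open>p, q\<close> that vanishes at
  \<open>i, j\<close>, hence zero as well.\<close>

lemma principal_minor_ne_0:
  fixes A :: "'a::field mat"
  assumes A: "A \<in> carrier_mat n n"
    and xy: "in_ker n (transpose_mat A) x" "in_ker n (transpose_mat A) y"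
    and pq: "spans_ker n A p q"
    and ij: "i < n" "j < n" "minor2 x y i j \<noteq> 0" "minor2 p q i j \<noteq> 0"
  shows "principal_minor A ({..<n} - {i, j}) \<noteq> 0"
proof
  let ?I = "{..<n} - {i, j}"
  assume "principal_minor A ?I = 0"
  then obtain v where v: "\<And>k. k \<in> ?I \<Longrightarrow> (\<Sum>l\<in>?I. A $$ (k, l) * v l) = 0" "\<exists>l\<in>?I. v l \<noteq> 0"
    using principal_minor_eq_0_iff[OF A, of ?I] by auto
  have neq: "i \<noteq> j"
    using ij by (auto simp: minor2_def)
  define w where "w l = (if l \<in> ?I then v l else 0)" for l
  define s where "s k = (\<Sum>l<n. A $$ (k, l) * w l)" for k
  have "s k = (\<Sum>l\<in>?I. A $$ (k, l) * v l)" for k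
    unfolding s_def w_def by (rule sum.mono_neutral_cong_right) auto
  then have s0: "s k = 0" if "k \<in> ?I" for k
    using v(1)[OF that] by simp
  have rel: "u i * s i + u j * s j = 0" if "in_ker n (transpose_mat A) u" for u
  proof -
    have "(\<Sum>k<n. u k * s k) = (\<Sum>k<n. \<Sum>l<n. u k * (A $$ (k, l) * w l))"
      by (simp add: s_def sum_distrib_left)
    also have "\<dots> = (\<Sum>l<n. w l * (\<Sum>k<n. A $$ (k, l) * u k))"
      by (subst sum.swap) (simp add: sum_distrib_left mult_ac)
    also have "\<dots> = 0"
      using that A by (intro sum.neutral) (auto simp: in_ker_def)
    finally have "(\<Sum>k<n. u k * s k) = 0" .
    moreover have "(\<Sum>k<n. u k * s k) = (\<Sum>k\<in>{i, j}. u k * s k)"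
      using ij s0 by (intro sum.mono_neutral_right) auto
    ultimately show ?thesis
      using neq by simp
  qed
  \<comment> \<open>Cramer's rule for two equations in \<open>s i, s j\<close>; the same is done
    below for \<open>\<alpha>, \<beta>\<close>.\<close>
  have "minor2 x y i j * s i = y j * (x i * s i + x j * s j) - x j * (y i * s i + y j * s j)"
    "minor2 x y i j * s j = x i * (y i * s i + y j * s j) - y i * (x i * s i + x j * s j)"
    by (simp_all add: minor2_def algebra_simps)
  then have "s i = 0" "s j = 0"
    using rel[OF xy(1)] rel[OF xy(2)] ij by auto
  then have "s k = 0" if "k < n" for k
    using s0 that by (cases "k = i"; cases "k = j") auto
  then have "in_ker n A w"
    by (simp add: in_ker_def s_def)
  then obtain \<alpha> \<beta> where w: "\<And>l. l < n \<Longrightarrow> w l = \<alpha> * p l + \<beta> * q l"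
    using pq unfolding spans_ker_def by blast
  have "\<alpha> * p i + \<beta> * q i = 0" "\<alpha> * p j + \<beta> * q j = 0"
    using w[of i] w[of j] ij by (auto simp: w_def)
  moreover have "minor2 p q i j * \<alpha> = q j * (\<alpha> * p i + \<beta> * q i) - q i * (\<alpha> * p j + \<beta> * q j)"
    "minor2 p q i j * \<beta> = p i * (\<alpha> * p j + \<beta> * q j) - p j * (\<alpha> * p i + \<beta> * q i)"
    by (simp_all add: minor2_def algebra_simps)
  ultimately have "\<alpha> = 0" "\<beta> = 0"
    using ij by auto
  moreover obtain l where "l \<in> ?I" "v l \<noteq> 0"
    using v(2) by blast
  ultimately show False
    using w[of l] by (simp add: w_def)
qed

section \<open>Supports and normal forms of the two kernels\<close>

definition support2 :: "nat \<Rightarrow> (nat \<Rightarrow> 'a::zero) \<Rightarrow> (nat \<Rightarrow> 'a) \<Rightarrow> nat set" where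
  "support2 n x y = {i. i < n \<and> (x i \<noteq> 0 \<or> y i \<noteq> 0)}"

text \<open>Being parallel is transitive only through a non-zero vector, since the zero vector is
  parallel to everything.\<close>

lemma minor2_trans:
  fixes x y :: "nat \<Rightarrow> 'a::field"
  assumes "minor2 x y i j = 0" "minor2 x y i k = 0" "x i \<noteq> 0 \<or> y i \<noteq> 0"
  shows "minor2 x y j k = 0"
proof -
  have "x i * minor2 x y j k = x j * minor2 x y i k - x k * minor2 x y i j"
    "y i * minor2 x y j k = y j * minor2 x y i k - y k * minor2 x y i j"
    by (simp_all add: minor2_def algebra_simps)
  then show ?thesis
    using assms by auto
qed

lemma minor2_commute: "minor2 x y i j = 0 \<longleftrightarrow> minor2 x y j i = (0 :: 'a::field)"
  by (auto simp: minor2_def)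

text \<open>On non-zero vectors being parallel is an equivalence relation, and if two equivalence
  relations together relate all pairs, one of them does so alone.\<close>

lemma one_family_parallel:
  fixes x y p q :: "nat \<Rightarrow> 'a::field"
  assumes nz: "\<And>i. i \<in> W \<Longrightarrow> x i \<noteq> 0 \<or> y i \<noteq> 0" "\<And>i. i \<in> W \<Longrightarrow> p i \<noteq> 0 \<or> q i \<noteq> 0"
    and par: "\<And>i j. i \<in> W \<Longrightarrow> j \<in> W \<Longrightarrow> i \<noteq> j \<Longrightarrow> minor2 x y i j = 0 \<or> minor2 p q i j = 0"
  shows "(\<forall>i\<in>W. \<forall>j\<in>W. minor2 x y i j = 0) \<or> (\<forall>i\<in>W. \<forall>j\<in>W. minor2 p q i j = 0)"
proof (rule disjCI)
  assume "\<not> (\<forall>i\<in>W. \<forall>j\<in>W. minor2 p q i j = 0)"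
  then obtain i j where ij: "i \<in> W" "j \<in> W" "minor2 p q i j \<noteq> 0"
    by blast
  then have "i \<noteq> j"
    by (auto simp: minor2_def)
  then have xij: "minor2 x y i j = 0"
    using par ij by blast
  \<comment> \<open>Otherwise \<open>k\<close> is related to \<open>i\<close> by
    \<open>p, q\<close>, hence not to \<open>j\<close>; so it is related to \<open>j\<close> by
    \<open>x, y\<close>, and through \<open>j\<close> to \<open>i\<close>.\<close>
  have "minor2 x y i k = 0" if k: "k \<in> W" for k
  proof (cases "minor2 x y i k = 0 \<or> k = i")
    case False
    then have "minor2 p q i k = 0"
      using par[of i k] ij k by blast
    have "minor2 p q k j \<noteq> 0"
      using minor2_trans[of p q k i j] \<open>minor2 p q i k = 0\<close> minor2_commute[of p q i k] ij nz(2)[OF k] by blast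
    then have "minor2 x y j k = 0"
      using par[of k j] k ij minor2_commute[of x y j k] by (auto simp: minor2_def)
    then show ?thesis
      using minor2_trans[of x y j i k] minor2_commute[of x y i j] xij nz(1)[OF ij(2)] by blast
  qed (auto simp: minor2_def)
  then show "\<forall>k\<in>W. \<forall>l\<in>W. minor2 x y k l = 0"
    using minor2_trans[of x y i] nz(1)[OF ij(1)] by blast
qed

type_synonym shape = "nat \<times> nat \<times> nat \<times> nat \<times> nat set \<times> nat set"

text \<open>\<open>V1\<close> and \<open>V2\<close> contain the supports of the families \<open>v\<^sub>i = (x i, y i)\<close> and
  \<open>w\<^sub>i = (p i, q i)\<close>, which are normalised at \<open>a, b\<close> and \<open>c, d\<close>. The vectors \<open>v\<^sub>i\<close> with
  \<open>i \<in> V1 \<inter> V2\<close> are multiples of \<open>v\<^sub>a\<close>, so that \<open>y\<close> is supported on \<open>V1 - V2\<close>.\<close>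

fun admissible :: "nat \<Rightarrow> shape \<Rightarrow> bool" where
  "admissible n (a, b, c, d, V1, V2) \<longleftrightarrow> V1 \<subseteq> {..<n} \<and> V2 \<subseteq> {..<n} \<and>
     a \<in> V1 \<and> b \<in> V1 \<and> a \<noteq> b \<and> c \<in> V2 \<and> d \<in> V2 \<and> c \<noteq> d \<and> b \<notin> V2 \<and> (a \<in> V2 \<or> V1 \<inter> V2 = {})"

fun has_shape :: "nat \<Rightarrow> 'a::comm_ring_1 mat \<Rightarrow> shape \<Rightarrow>
    (nat \<Rightarrow> 'a) \<Rightarrow> (nat \<Rightarrow> 'a) \<Rightarrow> (nat \<Rightarrow> 'a) \<Rightarrow> (nat \<Rightarrow> 'a) \<Rightarrow> bool" where
  "has_shape n A (a, b, c, d, V1, V2) x y p q \<longleftrightarrow>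
     ker_pair n (transpose_mat A) a b x y \<and> ker_pair n A c d p q \<and>
     (\<forall>i<n. i \<notin> V1 \<longrightarrow> x i = 0) \<and> (\<forall>i<n. i \<notin> V1 - V2 \<longrightarrow> y i = 0) \<and>
     (\<forall>i<n. i \<notin> V2 \<longrightarrow> p i = 0 \<and> q i = 0)"

text \<open>For disjoint supports the given normalisation works. Otherwise it is moved to an
  \<open>a\<close> in both supports and a \<open>b\<close> not parallel to it. Such a
  \<open>b\<close> lies outside \<open>V2\<close>, and the new \<open>y\<close> vanishes on
  \<open>V1 \<inter> V2\<close>.\<close>

lemma ex_shape_if_parallel:
  fixes A :: "'a::field mat"
  assumes xy: "ker_pair n (transpose_mat A) a0 b0 x0 y0" and pq: "ker_pair n A c d p q"
    and par: "\<forall>i\<in>support2 n x0 y0 \<inter> support2 n p q. \<forall>j\<in>support2 n x0 y0 \<inter> support2 n p q. minor2 x0 y0 i j = 0"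
  shows "\<exists>\<delta> x y. admissible n \<delta> \<and> has_shape n A \<delta> x y p q"
proof -
  define V1 V2 where "V1 = support2 n x0 y0" and "V2 = support2 n p q"
  have ab: "a0 < n" "b0 < n" "a0 \<noteq> b0" "x0 a0 = 1" "x0 b0 = 0" "y0 a0 = 0" "y0 b0 = 1"
    "in_ker n (transpose_mat A) x0" "in_ker n (transpose_mat A) y0"
    using xy by (auto simp: ker_pair_def)
  have cd: "c < n" "d < n" "c \<noteq> d" "p c = 1" "p d = 0" "q c = 0" "q d = 1"
    using pq by (auto simp: ker_pair_def)
  have V: "V1 \<subseteq> {..<n}" "V2 \<subseteq> {..<n}" "a0 \<in> V1" "b0 \<in> V1" "c \<in> V2" "d \<in> V2"
    using ab cd by (auto simp: V1_def V2_def support2_def)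
  show ?thesis
  proof (cases "V1 \<inter> V2 = {}")
    case True
    then have "admissible n (a0, b0, c, d, V1, V2)"
      using V ab cd by auto
    moreover have "has_shape n A (a0, b0, c, d, V1, V2) x0 y0 p q"
      using xy pq True by (auto simp: V1_def V2_def support2_def)
    ultimately show ?thesis
      by blast
  next
    case False
    then obtain a where a: "a \<in> V1" "a \<in> V2"
      by blast
    \<comment> \<open>The vectors at \<open>a0, b0\<close> are the standard basis, and a non-zero
      vector is not parallel to both.\<close>
    have "minor2 x0 y0 a a0 \<noteq> 0 \<or> minor2 x0 y0 a b0 \<noteq> 0"
      using a ab by (auto simp: V1_def support2_def minor2_def)
    then obtain b where b: "b \<in> V1" "minor2 x0 y0 a b \<noteq> 0"
      using V by blast
    then have bV2: "b \<notin> V2"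
      using a par by (auto simp: V1_def V2_def)
    have less: "a < n" "b < n"
      using a b V by auto
    define x where "x j = y0 b / minor2 x0 y0 a b * x0 j + (- x0 b / minor2 x0 y0 a b) * y0 j" for j
    define y where "y j = - y0 a / minor2 x0 y0 a b * x0 j + x0 a / minor2 x0 y0 a b * y0 j" for j
    have ker: "ker_pair n (transpose_mat A) a b x y"
      unfolding x_def[abs_def] y_def[abs_def] by (rule ker_pair_normalize(1)[OF ab(8,9) less b(2)])
    have y: "y j = minor2 x0 y0 a j / minor2 x0 y0 a b" for j
      by (simp add: y_def minor2_def diff_divide_distrib mult.commute)
    have "y i = 0" if "i < n" "i \<notin> V1 - V2" for i
    proof (cases "i \<in> V1")
      case True
      then have "minor2 x0 y0 a i = 0"
        using that a par by (auto simp: V1_def V2_def)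
      then show ?thesis
        by (simp add: y)
    next
      case False
      with \<open>i < n\<close> show ?thesis
        by (auto simp: y V1_def support2_def minor2_def)
    qed
    moreover have "x i = 0" if "i < n" "i \<notin> V1" for i
      using that by (auto simp: x_def V1_def support2_def)
    moreover have "p i = 0 \<and> q i = 0" if "i < n" "i \<notin> V2" for i
      using that by (auto simp: V2_def support2_def)
    ultimately have "has_shape n A (a, b, c, d, V1, V2) x y p q"
      using ker pq by simp
    moreover have "admissible n (a, b, c, d, V1, V2)"
      using V a b bV2 cd by auto
    ultimately show ?thesis
      by blast
  qed
qed

declare admissible.simps [simp del] has_shape.simps [simp del]

text \<open>Non-parallel pairs of both kinds at the same \<open>i, j\<close> would give a non-zero
  minor. If the right kernel is the parallel one, transposing exchanges the roles.\<close>

lemma principal_minor_locus_shape: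
  fixes A :: "'a::field mat"
  assumes n: "2 \<le> n" and A: "A \<in> principal_minor_locus n (n - 2) (n - 2)"
  shows "\<exists>\<delta> x y p q. admissible n \<delta> \<and>
    (has_shape n A \<delta> x y p q \<or> has_shape n (transpose_mat A) \<delta> x y p q)"
proof -
  have AC: "A \<in> carrier_mat n n" and rank: "vec_space.rank n A + 2 = n"
    and minors: "\<And>I. I \<subseteq> {..<n} \<Longrightarrow> card I = n - 2 \<Longrightarrow> principal_minor A I = 0"
    using A n by (auto simp: principal_minor_locus_def)
  obtain c d p q where pq: "ker_pair n A c d p q" "spans_ker n A p q"
    using corank_two_ker_pair[OF AC rank] by blast
  obtain a b x y where xy: "ker_pair n (transpose_mat A) a b x y"
    using corank_two_left_ker[OF AC pq(1)] by blast
  let ?W = "support2 n x y \<inter> support2 n p q"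
  have "minor2 x y i j = 0 \<or> minor2 p q i j = 0" if "i \<in> ?W" "j \<in> ?W" "i \<noteq> j" for i j
  proof -
    have ij: "i < n" "j < n"
      using that by (auto simp: support2_def)
    then have "card ({..<n} - {i, j}) = n - 2"
      using \<open>i \<noteq> j\<close> by (subst card_Diff_subset) auto
    then have "principal_minor A ({..<n} - {i, j}) = 0"
      by (intro minors) auto
    then show ?thesis
      using principal_minor_ne_0[OF AC _ _ pq(2) ij] xy by (auto simp: ker_pair_def)
  qed
  then have "(\<forall>i\<in>?W. \<forall>j\<in>?W. minor2 x y i j = 0) \<or> (\<forall>i\<in>?W. \<forall>j\<in>?W. minor2 p q i j = 0)"
    by (intro one_family_parallel) (auto simp: support2_def)
  then show ?thesis
  proof
    assume "\<forall>i\<in>?W. \<forall>j\<in>?W. minor2 x y i j = 0"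
    then show ?thesis
      using ex_shape_if_parallel[OF xy pq(1)] by blast
  next
    assume "\<forall>i\<in>?W. \<forall>j\<in>?W. minor2 p q i j = 0"
    then have "\<exists>\<delta> x' y'. admissible n \<delta> \<and> has_shape n (transpose_mat A) \<delta> x' y' x y"
      using xy pq(1) by (intro ex_shape_if_parallel) auto
    then show ?thesis
      by blast
  qed
qed

section \<open>Counting polynomial generators for each shape\<close>

lemma ker_pair_entry:
  fixes A :: "'a::comm_ring_1 mat"
  assumes "ker_pair n A c d p q" "i < n"
  shows "A $$ (i, c) = - (\<Sum>l\<in>{..<n} - {c, d}. A $$ (i, l) * p l)"
    "A $$ (i, d) = - (\<Sum>l\<in>{..<n} - {c, d}. A $$ (i, l) * q l)"
proof -
  have cd: "c < n" "d < n" "c \<noteq> d" "p c = 1" "p d = 0" "q c = 0" "q d = 1"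
    using assms by (auto simp: ker_pair_def)
  have split: "(\<Sum>l<n. h l) = h c + h d + (\<Sum>l\<in>{..<n} - {c, d}. h l)" for h :: "nat \<Rightarrow> 'a"
    using cd sum.subset_diff[of "{c, d}" "{..<n}" h] by simp
  have "(\<Sum>l<n. A $$ (i, l) * p l) = 0" "(\<Sum>l<n. A $$ (i, l) * q l) = 0"
    using assms by (auto simp: ker_pair_def in_ker_def)
  then show "A $$ (i, c) = - (\<Sum>l\<in>{..<n} - {c, d}. A $$ (i, l) * p l)"
    "A $$ (i, d) = - (\<Sum>l\<in>{..<n} - {c, d}. A $$ (i, l) * q l)"
    using cd unfolding split by (simp_all add: eq_neg_iff_add_eq_0)
qed

text \<open>The kernel entries number at most \<open>3n - 8\<close>. If \<open>a \<in> V2\<close>,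
  add the bounds \<open>n\<close> for \<open>V1 \<union> V2\<close>, \<open>n\<close> for
  \<open>V1\<close> and \<open>n - 1\<close> for \<open>V2\<close>, which misses \<open>b\<close>.
  If \<open>a \<notin> V2\<close>, the supports are disjoint and \<open>2n - 8\<close>
  suffices.\<close>

lemma admissible_card:
  assumes "admissible n (a, b, c, d, V1, V2)" "3 \<le> n"
  shows "(n - 2) * (n - 2) + (card (V1 - {a, b}) + card (V1 - V2 - {a, b}) + 2 * card (V2 - {c, d}))
    \<le> n * n - n - 4"
proof -
  have V: "V1 \<subseteq> {..<n}" "V2 \<subseteq> {..<n}" "a \<in> V1" "b \<in> V1" "a \<noteq> b" "c \<in> V2" "d \<in> V2" "c \<noteq> d" "b \<notin> V2"
    "a \<in> V2 \<or> V1 \<inter> V2 = {}"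
    using assms by (auto simp: admissible.simps)
  have fin: "finite V1" "finite V2"
    using V finite_subset by blast+
  define m1 m2 c' where "m1 = card V1" and "m2 = card V2" and "c' = card (V1 \<inter> V2)"
  have c1: "card (V1 - {a, b}) = m1 - 2" "card (V2 - {c, d}) = m2 - 2"
    using V fin by (auto simp: card_Diff_subset m1_def m2_def)
  have m: "2 \<le> m1" "2 \<le> m2"
    using card_mono[of V1 "{a, b}"] card_mono[of V2 "{c, d}"] V fin by (auto simp: m1_def m2_def)
  have un: "m1 + m2 = card (V1 \<union> V2) + c'"
    using card_Un_Int[OF fin] by (simp add: m1_def m2_def c'_def)
  have un_le: "card (V1 \<union> V2) \<le> n"
    using V card_mono[of "{..<n}" "V1 \<union> V2"] by auto
  have m1n: "m1 \<le> n"
    using V card_mono[of "{..<n}" V1] by (auto simp: m1_def)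
  have "V2 \<subseteq> {..<n} - {b}"
    using V by auto
  then have "m2 \<le> card ({..<n} - {b})"
    unfolding m2_def by (intro card_mono) auto
  then have m2n: "m2 + 1 \<le> n"
    using V assms by (auto simp: card_Diff_subset)
  have "card ((V1 - V2) \<union> (V1 \<inter> V2)) = card (V1 - V2) + card (V1 \<inter> V2)"
    using fin by (intro card_Un_disjoint) auto
  then have diff: "card (V1 - V2) + c' = m1"
    by (simp add: m1_def c'_def Un_Diff_Int)
  have "card (V1 - {a, b}) + card (V1 - V2 - {a, b}) + 2 * card (V2 - {c, d}) + 8 \<le> 3 * n"
  proof (cases "a \<in> V2")
    case True
    then have "V1 - V2 - {a, b} = V1 - V2 - {b}"
      by auto
    then have "card (V1 - V2 - {a, b}) + 1 = card (V1 - V2)"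
      using card_Suc_Diff1[of "V1 - V2" b] V fin by simp
    then show ?thesis
      using c1 m un un_le m1n m2n diff by linarith
  next
    case False
    then have "c' = 0"
      using V by (simp add: c'_def)
    moreover have "card (V1 - V2 - {a, b}) \<le> m1 - 2"
      unfolding c1(1)[symmetric] using fin by (intro card_mono) auto
    ultimately show ?thesis
      using c1 m un un_le m1n m2n assms(2) by linarith
  qed
  moreover obtain k where "n = k + 3"
    using assms(2) by (metis add.commute le_Suc_ex)
  ultimately show ?thesis
    by (simp add: algebra_simps)
qed

text \<open>The generators are the entries outside rows \<open>a, b\<close> and columns
  \<open>c, d\<close>, together with the kernel entries not fixed by the shape. \<open>E\<close>
  will be the identity or transposition.\<close>

lemma has_shape_generators:
  fixes E :: "'x \<Rightarrow> 'a::comm_ring_1 mat"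
  assumes n: "3 \<le> n" and adm: "admissible n \<delta>"
    and E: "\<And>z. z \<in> X \<Longrightarrow> E z \<in> carrier_mat n n"
    and shape: "\<And>z. z \<in> X \<Longrightarrow> \<exists>x y p q. has_shape n (E z) \<delta> x y p q"
  shows "\<exists>H. finite H \<and> card H \<le> n * n - n - 4 \<and> (\<forall>i<n. \<forall>j<n. (\<lambda>z. E z $$ (i, j)) \<in> gen_alg X H)"
proof -
  obtain a b c d V1 V2 where \<delta>: "\<delta> = (a, b, c, d, V1, V2)"
    by (cases \<delta>) auto
  have V: "V1 \<subseteq> {..<n}" "V2 \<subseteq> {..<n}" "a < n" "b < n" "a \<noteq> b" "c < n" "d < n" "c \<noteq> d"
    using adm by (auto simp: \<delta> admissible.simps)
  \<comment> \<open>The four kernel vectors are packed into one tuple and chosen as functions of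
    \<open>z\<close>.\<close>
  have "\<forall>z\<in>X. \<exists>w. has_shape n (E z) \<delta> (fst w) (fst (snd w)) (fst (snd (snd w))) (snd (snd (snd w)))"
    using shape by simp
  then obtain w where w: "\<forall>z\<in>X. has_shape n (E z) \<delta> (fst (w z)) (fst (snd (w z)))
      (fst (snd (snd (w z)))) (snd (snd (snd (w z))))"
    using bchoice by meson
  define x y p q where "x z = fst (w z)" and "y z = fst (snd (w z))" and
    "p z = fst (snd (snd (w z)))" and "q z = snd (snd (snd (w z)))" for z
  have xy: "ker_pair n (transpose_mat (E z)) a b (x z) (y z)" and pq: "ker_pair n (E z) c d (p z) (q z)"
    and x0: "\<And>i. i < n \<Longrightarrow> i \<notin> V1 \<Longrightarrow> x z i = 0" and y0: "\<And>i. i < n \<Longrightarrow> i \<notin> V1 - V2 \<Longrightarrow> y z i = 0"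
    and p0: "\<And>i. i < n \<Longrightarrow> i \<notin> V2 \<Longrightarrow> p z i = 0" and q0: "\<And>i. i < n \<Longrightarrow> i \<notin> V2 \<Longrightarrow> q z i = 0"
    if "z \<in> X" for z
    using w that by (auto simp: \<delta> has_shape.simps x_def y_def p_def q_def)
  define R S where "R = {..<n} - {a, b}" and "S = {..<n} - {c, d}"
  define H0 where "H0 = (\<lambda>(k, l) z. E z $$ (k, l)) ` (R \<times> S)"
  define H1 where "H1 = (\<lambda>k z. x z k) ` (V1 - {a, b})"
  define H2 where "H2 = (\<lambda>k z. y z k) ` (V1 - V2 - {a, b})"
  define H3 where "H3 = (\<lambda>k z. p z k) ` (V2 - {c, d})"
  define H4 where "H4 = (\<lambda>k z. q z k) ` (V2 - {c, d})"
  define H where "H = H0 \<union> H1 \<union> H2 \<union> H3 \<union> H4"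
  have fin: "finite V1" "finite V2"
    using V finite_subset by blast+
  have "card H \<le> card H0 + card H1 + card H2 + card H3 + card H4"
    unfolding H_def using card_Un_le by (meson add_mono le_trans order_refl)
  also have "\<dots> \<le> (n - 2) * (n - 2) + card (V1 - {a, b}) + card (V1 - V2 - {a, b}) + card (V2 - {c, d})
      + card (V2 - {c, d})"
  proof (intro add_mono)
    have "card R = n - 2" "card S = n - 2"
      using V by (auto simp: R_def S_def card_Diff_subset)
    then show "card H0 \<le> (n - 2) * (n - 2)"
      unfolding H0_def using card_image_le[of "R \<times> S"]
      by (metis R_def S_def card_cartesian_product finite_Diff finite_SigmaI finite_lessThan)
  qed (use fin in \<open>auto simp: H1_def H2_def H3_def H4_def intro!: card_image_le\<close>)
  also have "\<dots> \<le> n * n - n - 4"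
    using admissible_card[OF adm[unfolded \<delta>] n] by simp
  finally have card: "card H \<le> n * n - n - 4" .
  have finH: "finite H"
    using fin by (simp add: H_def H0_def H1_def H2_def H3_def H4_def R_def S_def)
  have zero: "f \<in> gen_alg X H" if "\<And>z. z \<in> X \<Longrightarrow> f z = c" for f and c :: 'a
    using that by (rule gen_alg_cong[OF gen_alg_const[of c]])
  have gx: "(\<lambda>z. x z i) \<in> gen_alg X H" if "i < n" for i
  proof -
    consider "i \<notin> V1" | "i = a" | "i = b" | "i \<in> V1 - {a, b}"
      by blast
    then show ?thesis
    proof cases
      case 4
      then show ?thesis
        by (intro gen_alg_gen) (auto simp: H_def H1_def)
    qed (use x0[OF _ that] xy zero in \<open>auto simp: ker_pair_def\<close>)
  qed
  have gy: "(\<lambda>z. y z i) \<in> gen_alg X H" if "i < n" for i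
  proof -
    consider "i \<notin> V1 - V2" | "i = a" | "i = b" | "i \<in> V1 - V2 - {a, b}"
      by blast
    then show ?thesis
    proof cases
      case 4
      then show ?thesis
        by (intro gen_alg_gen) (auto simp: H_def H2_def)
    qed (use y0[OF _ that] xy zero in \<open>auto simp: ker_pair_def\<close>)
  qed
  have gp: "(\<lambda>z. p z i) \<in> gen_alg X H" if "i < n" for i
  proof -
    consider "i \<notin> V2" | "i = c" | "i = d" | "i \<in> V2 - {c, d}"
      by blast
    then show ?thesis
    proof cases
      case 4
      then show ?thesis
        by (intro gen_alg_gen) (auto simp: H_def H3_def)
    qed (use p0[OF _ that] pq zero in \<open>auto simp: ker_pair_def\<close>)
  qed
  have gq: "(\<lambda>z. q z i) \<in> gen_alg X H" if "i < n" for i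
  proof -
    consider "i \<notin> V2" | "i = c" | "i = d" | "i \<in> V2 - {c, d}"
      by blast
    then show ?thesis
    proof cases
      case 4
      then show ?thesis
        by (intro gen_alg_gen) (auto simp: H_def H4_def)
    qed (use q0[OF _ that] pq zero in \<open>auto simp: ker_pair_def\<close>)
  qed
  \<comment> \<open>The right kernel recovers columns \<open>c, d\<close> in the rows other than
    \<open>a, b\<close>; the left kernel then recovers rows \<open>a, b\<close>.\<close>
  have row: "(\<lambda>z. E z $$ (i, j)) \<in> gen_alg X H" if i: "i \<in> R" and j: "j < n" for i j
  proof -
    have S: "(\<lambda>z. E z $$ (i, l)) \<in> gen_alg X H" if "l \<in> S" for l
      using i that by (intro gen_alg_gen) (force simp: H_def H0_def)
    have iR: "i < n"
      using i by (simp add: R_def)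
    have "(\<lambda>z. - (\<Sum>l\<in>S. E z $$ (i, l) * p z l)) \<in> gen_alg X H"
      "(\<lambda>z. - (\<Sum>l\<in>S. E z $$ (i, l) * q z l)) \<in> gen_alg X H"
      by (intro gen_alg_uminus gen_alg_sum gen_alg_mult S gp gq; simp add: S_def)+
    then have "(\<lambda>z. E z $$ (i, c)) \<in> gen_alg X H" "(\<lambda>z. E z $$ (i, d)) \<in> gen_alg X H"
      using ker_pair_entry[OF pq iR] by - (rule gen_alg_cong, assumption, simp add: S_def)+
    then show ?thesis
      using S[of j] j by (cases "j = c"; cases "j = d") (auto simp: S_def)
  qed
  have "(\<lambda>z. E z $$ (i, j)) \<in> gen_alg X H" if i: "i < n" and j: "j < n" for i j
  proof -
    have "(\<lambda>z. - (\<Sum>k\<in>R. E z $$ (k, j) * x z k)) \<in> gen_alg X H"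
      "(\<lambda>z. - (\<Sum>k\<in>R. E z $$ (k, j) * y z k)) \<in> gen_alg X H"
      by (intro gen_alg_uminus gen_alg_sum gen_alg_mult row gx gy; simp add: R_def j)+
    moreover have "E z $$ (a, j) = - (\<Sum>k\<in>R. E z $$ (k, j) * x z k)"
      "E z $$ (b, j) = - (\<Sum>k\<in>R. E z $$ (k, j) * y z k)" if "z \<in> X" for z
      using ker_pair_entry[OF xy[OF that] j] E[OF that] V j by (simp_all add: R_def)
    ultimately have "(\<lambda>z. E z $$ (a, j)) \<in> gen_alg X H" "(\<lambda>z. E z $$ (b, j)) \<in> gen_alg X H"
      by - (rule gen_alg_cong, assumption, simp)+
    then show ?thesis
      using row[of i j] i j by (cases "i = a"; cases "i = b") (auto simp: R_def)
  qed
  with finH card show ?thesis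
    by blast
qed

text \<open>The locus is covered by finitely many pieces, one for each shape and each choice of
  transposing or not.\<close>

proposition krull_dim_principal_minor_locus_le:
  assumes n: "3 \<le> n"
  shows "krull_dim (subtopology (zariski_topology n)
    (principal_minor_locus n (n - 2) (n - 2) :: 'a::field mat set)) \<le> ereal (real (n * n - n - 4))"
proof (rule krull_dim_le)
  let ?Y = "principal_minor_locus n (n - 2) (n - 2) :: 'a mat set"
  define T where "T tr A = (if tr then transpose_mat A else A)" for tr and A :: "'a mat"
  define piece where "piece = (\<lambda>(tr, \<delta>). {A. \<exists>x y p q. has_shape n (T tr A) \<delta> x y p q})"
  let ?\<U> = "piece ` (UNIV \<times> {\<delta>. admissible n \<delta>})"
  show "?Y \<subseteq> carrier_mat n n"
    by (auto simp: principal_minor_locus_def)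
  have "{\<delta>. admissible n \<delta>} \<subseteq> {..<n} \<times> {..<n} \<times> {..<n} \<times> {..<n} \<times> Pow {..<n} \<times> Pow {..<n}"
    by (auto simp: admissible.simps)
  then have "finite {\<delta>. admissible n \<delta>}"
    by (rule finite_subset) auto
  then show "finite ?\<U>"
    by simp
  show "?Y \<subseteq> \<Union>?\<U>"
  proof
    fix A assume "A \<in> ?Y"
    then obtain \<delta> x y p q where "admissible n \<delta>"
      "has_shape n A \<delta> x y p q \<or> has_shape n (transpose_mat A) \<delta> x y p q"
      using principal_minor_locus_shape[of n A] n
      by (metis One_nat_def Suc_1 Suc_leD numeral_3_eq_3)
    then have "A \<in> piece (False, \<delta>) \<or> A \<in> piece (True, \<delta>)" "admissible n \<delta>"
      by (auto simp: piece_def T_def)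
    then show "A \<in> \<Union>?\<U>"
      by blast
  qed
  fix U assume "U \<in> ?\<U>"
  then obtain tr \<delta> where \<delta>: "admissible n \<delta>" and U: "U = piece (tr, \<delta>)"
    by auto
  let ?X = "U \<inter> carrier_mat n n"
  obtain H where H: "finite H" "card H \<le> n * n - n - 4"
    "\<And>i j. i < n \<Longrightarrow> j < n \<Longrightarrow> (\<lambda>A. T tr A $$ (i, j)) \<in> gen_alg ?X H"
  proof -
    have "T tr A \<in> carrier_mat n n" "\<exists>x y p q. has_shape n (T tr A) \<delta> x y p q" if "A \<in> ?X" for A
      using that by (auto simp: U piece_def T_def)
    then show ?thesis
      using has_shape_generators[OF n \<delta>, of ?X "T tr"] that by blast
  qed
  have "(\<lambda>A. A $$ (i, j)) \<in> gen_alg ?X H" if "i < n" "j < n" for i j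
  proof (cases tr)
    case True
    then show ?thesis
      using that by (intro gen_alg_cong[OF H(3)[of j i]]) (auto simp: T_def)
  next
    case False
    then show ?thesis
      using H(3)[OF that] by (simp add: T_def)
  qed
  then have "mat_coords n \<subseteq> gen_alg ?X H"
    by (auto simp: mat_coords_def)
  with H show "\<exists>H. finite H \<and> card H \<le> n * n - n - 4 \<and> mat_coords n \<subseteq> gen_alg ?X H"
    by blast
qed

subsection \<open>The lower bound\<close>

text \<open>Over a finite field, 1 plus the product of all \<open>X - a\<close> would be a
  non-constant polynomial without roots.\<close>

lemma infinite_UNIV_alg_closed: "infinite (UNIV :: 'a::alg_closed_field set)"
proof
  assume fin: "finite (UNIV :: 'a set)"
  define p where "p = (\<Prod>a\<in>UNIV. [:-a, 1:] :: 'a poly)"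
  have "degree p = (\<Sum>a\<in>(UNIV :: 'a set). degree [:-a, 1:])"
    unfolding p_def by (rule degree_prod_eq_sum_degree) auto
  then have "degree p = card (UNIV :: 'a set)"
    by simp
  then have "0 < degree (p + 1)"
    using fin by (subst degree_add_eq_left) (auto simp: finite_UNIV_card_ge_0)
  then obtain x where "poly (p + 1) x = 0"
    using alg_closed_imp_poly_has_root by blast
  moreover have "poly p x = 0"
    using fin by (auto simp: p_def poly_prod)
  ultimately show False
    by simp
qed

section \<open>Polynomial functions on a line\<close>

lemma gen_alg_id_imp_poly:
  fixes f :: "'a::comm_ring_1 \<Rightarrow> 'a"
  assumes "f \<in> gen_alg UNIV {\<lambda>t. t}"
  shows "\<exists>p. \<forall>t. f t = poly p t"
  using assms
proof induction
  case (gen_alg_const c)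
  show ?case
    by (rule exI[of _ "[:c:]"]) simp
next
  case (gen_alg_gen g)
  then show ?case
    by (intro exI[of _ "[:0, 1:]"]) simp
next
  case (gen_alg_add f g)
  then obtain p q where "\<forall>t. f t = poly p t" "\<forall>t. g t = poly q t"
    by blast
  then show ?case
    by (intro exI[of _ "p + q"]) simp
next
  case (gen_alg_mult f g)
  then obtain p q where "\<forall>t. f t = poly p t" "\<forall>t. g t = poly q t"
    by blast
  then show ?case
    by (intro exI[of _ "p * q"]) simp
qed simp

lemma prime_on_line:
  assumes "infinite (UNIV :: 'a::idom set)"
  shows "prime_on (gen_alg UNIV {\<lambda>t. t}) (UNIV :: 'a set)"
  unfolding prime_on_def
proof (intro conjI ballI impI)
  fix f g :: "'a \<Rightarrow> 'a"
  assume fg: "f \<in> gen_alg UNIV {\<lambda>t. t}" "g \<in> gen_alg UNIV {\<lambda>t. t}" "\<forall>t\<in>UNIV. f t * g t = 0"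
  obtain p q where pq: "\<And>t. f t = poly p t" "\<And>t. g t = poly q t"
    using gen_alg_id_imp_poly[OF fg(1)] gen_alg_id_imp_poly[OF fg(2)] by blast
  have "p * q = 0"
  proof (rule ccontr)
    assume "p * q \<noteq> 0"
    then have "finite {t. poly (p * q) t = 0}"
      by (rule poly_roots_finite)
    moreover have "{t. poly (p * q) t = 0} = UNIV"
      using fg(3) by (simp add: pq)
    ultimately show False
      using assms by metis
  qed
  then show "(\<forall>t\<in>UNIV. f t = 0) \<or> (\<forall>t\<in>UNIV. g t = 0)"
    by (auto simp: pq)
qed simp

text \<open>Two non-empty open subsets of a line over an infinite domain meet.\<close>

lemma line_common_nonzero:
  fixes f g :: "'a::idom \<Rightarrow> 'a"
  assumes "infinite (UNIV :: 'a set)"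
    and "f \<in> gen_alg UNIV {\<lambda>t. t}" "g \<in> gen_alg UNIV {\<lambda>t. t}" "f a \<noteq> 0" "g b \<noteq> 0"
  shows "\<exists>t. f t \<noteq> 0 \<and> g t \<noteq> 0"
  using prime_on_cases[OF prime_on_line[OF assms(1)] assms(2,3)] assms(4,5) by auto

lemma det_gen_alg:
  assumes "\<And>i j. i < m \<Longrightarrow> j < m \<Longrightarrow> (\<lambda>t. E t (i, j)) \<in> gen_alg X G"
  shows "(\<lambda>t. det (mat m m (E t))) \<in> gen_alg X G"
proof -
  have "(\<lambda>t. \<Sum>p\<in>{p. p permutes {0..<m}}. signof p * (\<Prod>i = 0..<m. E t (i, p i))) \<in> gen_alg X G"
    using permutes_in_image
    by (intro gen_alg_sum gen_alg_mult gen_alg_const gen_alg_prod assms) fastforce+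
  moreover have "det (mat m m (E t)) = (\<Sum>p\<in>{p. p permutes {0..<m}}. signof p * (\<Prod>i = 0..<m. E t (i, p i)))" for t
    unfolding det_def by (auto intro!: sum.cong prod.cong simp: permutes_in_image)
  ultimately show ?thesis
    by simp
qed

lemma in_ker_eq_0:
  fixes A :: "'a::field mat"
  assumes A: "A \<in> carrier_mat m m" "det A \<noteq> 0" and v: "in_ker m A v" and j: "j < m"
  shows "v j = 0"
proof (rule ccontr)
  assume "v j \<noteq> 0"
  then have "vec m v \<noteq> 0\<^sub>v m"
    using j by (metis index_vec index_zero_vec(1))
  moreover have "vec m v \<in> mat_kernel A"
    using v unfolding vec_in_mat_kernel_iff[OF A(1)] by (simp add: in_ker_def)
  ultimately show False
    using A det_0_iff_vec_prod_zero_field[OF A(1)] mat_kernel[OF A(1)] by blast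
qed

text \<open>The block on \<open>I\<close> is completed by identity rows to an \<open>n\<close> by
  \<open>n\<close> system with a zero row. A non-trivial solution vanishes outside \<open>I\<close>,
  so it is one for the block.\<close>

lemma principal_minor_zero_row:
  fixes A :: "'a::field mat"
  assumes A: "A \<in> carrier_mat n n" and I: "I \<subseteq> {..<n}" "c \<in> I" and row: "\<And>j. j < n \<Longrightarrow> A $$ (c, j) = 0"
  shows "principal_minor A I = 0"
proof -
  let ?f = "\<lambda>i j. if i \<in> I then (if j \<in> I then A $$ (i, j) else 0) else if j = i then 1 else 0"
  have "?f c j = 0" for j
    using I row by auto
  then obtain v where v: "\<And>i. i < n \<Longrightarrow> (\<Sum>j<n. ?f i j * v j) = 0" "\<exists>j<n. v j \<noteq> 0"
    using ex_in_ker_if_zero_row[of c n ?f] I by blast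
  have "v i = 0" if "i < n" "i \<notin> I" for i
    using v(1)[OF that(1)] that by (simp add: if_distrib[of "\<lambda>c. c * _"] cong: if_cong)
  moreover have "(\<Sum>j\<in>I. A $$ (i, j) * v j) = 0" if "i \<in> I" for i
  proof -
    have "(\<Sum>j\<in>I. A $$ (i, j) * v j) = (\<Sum>j<n. ?f i j * v j)"
      using I that by (intro sum.mono_neutral_cong_left) auto
    then show ?thesis
      using v(1)[of i] that I by auto
  qed
  ultimately show ?thesis
    unfolding principal_minor_eq_0_iff[OF A I(1)] using v(2) by blast
qed

section \<open>The polynomial family that attains the bound\<close>

lemma sum_lessThan_plus_3: "(\<Sum>j<s + 3. h j) = (\<Sum>j<s. h j) + h s + h (s + 1) + h (s + 2)"
  for h :: "nat \<Rightarrow> 'a::comm_monoid_add"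
  by (simp add: numeral_3_eq_3 add.assoc)

text \<open>In block form with row heights \<open>s, 2, 1\<close> and column widths \<open>s, 2, 1\<close> the family consists of
  the matrices with rows \<open>(M, MC, u)\<close>, \<open>(BM, BMC, Bu + w)\<close> and \<open>0\<close>. The parameters are the entries of
  \<open>M, C, u, B, w\<close>, each stored in \<open>\<theta>\<close> at the position of the block that it determines.\<close>

definition top_row :: "nat \<Rightarrow> (nat \<times> nat \<Rightarrow> 'a::comm_ring_1) \<Rightarrow> nat \<Rightarrow> nat \<Rightarrow> 'a" where
  "top_row s \<theta> k j = (if j = s \<or> j = s + 1 then (\<Sum>l<s. \<theta> (k, l) * \<theta> (l, j)) else \<theta> (k, j))"

definition family :: "nat \<Rightarrow> (nat \<times> nat \<Rightarrow> 'a::comm_ring_1) \<Rightarrow> 'a mat" where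
  "family s \<theta> = mat (s + 3) (s + 3) (\<lambda>(i, j).
     if i < s then top_row s \<theta> i j
     else if i < s + 2 then (\<Sum>k<s. \<theta> (i, k) * top_row s \<theta> k j) + (if j = s + 2 then \<theta> (i, j) else 0)
     else 0)"

text \<open>Invertibility of \<open>M\<close> and a non-zero first entry of \<open>w\<close>: an
  open condition under which the rank is exactly \<open>s + 1\<close>.\<close>

definition nondeg :: "nat \<Rightarrow> (nat \<times> nat \<Rightarrow> 'a::comm_ring_1) \<Rightarrow> 'a" where
  "nondeg s \<theta> = det (mat s s \<theta>) * \<theta> (s, s + 2)"

lemma family_carrier [simp]: "family s \<theta> \<in> carrier_mat (s + 3) (s + 3)"
  by (simp add: family_def)

lemma family_top: "i < s \<Longrightarrow> j < s + 3 \<Longrightarrow> family s \<theta> $$ (i, j) = top_row s \<theta> i j"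
  by (simp add: family_def)

lemma family_middle: "i = s \<or> i = s + 1 \<Longrightarrow> j < s + 3 \<Longrightarrow> family s \<theta> $$ (i, j) =
    (\<Sum>k<s. \<theta> (i, k) * top_row s \<theta> k j) + (if j = s + 2 then \<theta> (i, j) else 0)"
  by (auto simp: family_def)

lemma family_bottom: "i = s + 2 \<Longrightarrow> j < s + 3 \<Longrightarrow> family s \<theta> $$ (i, j) = 0"
  by (simp add: family_def)

text \<open>Subtracting \<open>B\<close> times the top rows from the middle ones leaves
  \<open>w\<close> times \<open>v (s + 2)\<close>, which forces that entry to vanish. The top rows
  then say that \<open>M\<close> kills the top part of \<open>v\<close> plus \<open>C\<close> times
  its middle part.\<close>

lemma family_in_ker_iff:
  fixes \<theta> :: "nat \<times> nat \<Rightarrow> 'a::field"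
  assumes "\<theta> (s, s + 2) \<noteq> 0"
  shows "in_ker (s + 3) (family s \<theta>) v \<longleftrightarrow> v (s + 2) = 0 \<and>
    in_ker s (mat s s \<theta>) (\<lambda>l. v l + \<theta> (l, s) * v s + \<theta> (l, s + 1) * v (s + 1))"
proof -
  define r where "r k = (\<Sum>j<s + 3. top_row s \<theta> k j * v j)" for k
  have top: "(\<Sum>j<s + 3. family s \<theta> $$ (i, j) * v j) = r i" if "i < s" for i
    unfolding r_def using that by (intro sum.cong) (auto simp: family_top)
  have mid: "(\<Sum>j<s + 3. family s \<theta> $$ (i, j) * v j) = (\<Sum>k<s. \<theta> (i, k) * r k) + \<theta> (i, s + 2) * v (s + 2)"
    if "i = s \<or> i = s + 1" for i
  proof -
    have "(\<Sum>j<s + 3. family s \<theta> $$ (i, j) * v j) =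
        (\<Sum>j<s + 3. (\<Sum>k<s. \<theta> (i, k) * top_row s \<theta> k j * v j) + (if j = s + 2 then \<theta> (i, j) * v j else 0))"
      using that by (intro sum.cong) (auto simp: family_middle sum_distrib_right distrib_right)
    also have "\<dots> = (\<Sum>k<s. \<Sum>j<s + 3. \<theta> (i, k) * top_row s \<theta> k j * v j) + \<theta> (i, s + 2) * v (s + 2)"
      by (subst sum.swap) (simp add: sum.distrib)
    finally show ?thesis
      by (simp add: r_def sum_distrib_left mult.assoc)
  qed
  have bot: "(\<Sum>j<s + 3. family s \<theta> $$ (s + 2, j) * v j) = 0"
    by (intro sum.neutral) (simp add: family_bottom)
  have r: "r k = (\<Sum>l<s. mat s s \<theta> $$ (k, l) * (v l + \<theta> (l, s) * v s + \<theta> (l, s + 1) * v (s + 1)))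
      + \<theta> (k, s + 2) * v (s + 2)" if "k < s" for k
    unfolding r_def sum_lessThan_plus_3 using that
    by (simp add: top_row_def algebra_simps sum.distrib sum_distrib_left sum_distrib_right)
  have all: "(\<forall>i<s + 3. P i) \<longleftrightarrow> (\<forall>i<s. P i) \<and> P s \<and> P (s + 1) \<and> P (s + 2)" for P
    by (auto simp: numeral_3_eq_3 less_Suc_eq)
  show ?thesis
    unfolding in_ker_def all using top mid bot r assms by (auto simp: in_ker_def)
qed

text \<open>As \<open>M\<close> is invertible, the kernel is spanned by the two columns of the block
  matrix with rows \<open>- C\<close>, the identity and \<open>0\<close>.\<close>

lemma family_ker_pair:
  fixes \<theta> :: "nat \<times> nat \<Rightarrow> 'a::field"
  assumes "nondeg s \<theta> \<noteq> 0"
  defines "p \<equiv> \<lambda>j. if j < s then - \<theta> (j, s) else if j = s then 1 else 0"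
    and "q \<equiv> \<lambda>j. if j < s then - \<theta> (j, s + 1) else if j = s + 1 then 1 else 0"
  shows "ker_pair (s + 3) (family s \<theta>) s (s + 1) p q" "spans_ker (s + 3) (family s \<theta>) p q"
proof -
  have nz: "det (mat s s \<theta>) \<noteq> 0" "\<theta> (s, s + 2) \<noteq> 0"
    using assms(1) by (auto simp: nondeg_def)
  note iff = family_in_ker_iff[of \<theta>, OF nz(2)]
  have "in_ker (s + 3) (family s \<theta>) p" "in_ker (s + 3) (family s \<theta>) q"
    unfolding iff by (auto simp: in_ker_def p_def q_def)
  then show "ker_pair (s + 3) (family s \<theta>) s (s + 1) p q"
    by (simp add: ker_pair_def p_def q_def)
  show "spans_ker (s + 3) (family s \<theta>) p q"
    unfolding spans_ker_def
  proof (intro allI impI)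
    fix v assume "in_ker (s + 3) (family s \<theta>) v"
    then have v: "v (s + 2) = 0"
      "in_ker s (mat s s \<theta>) (\<lambda>l. v l + \<theta> (l, s) * v s + \<theta> (l, s + 1) * v (s + 1))"
      unfolding iff by auto
    have top: "v l + \<theta> (l, s) * v s + \<theta> (l, s + 1) * v (s + 1) = 0" if "l < s" for l
      using in_ker_eq_0[OF _ nz(1) v(2) that] by simp
    have "v j = v s * p j + v (s + 1) * q j" if j: "j < s + 3" for j
    proof -
      consider "j < s" | "j = s" | "j = s + 1" | "j = s + 2"
        using j by linarith
      then show ?thesis
      proof cases
        case 1
        then show ?thesis
          using top[OF 1] by (simp add: p_def q_def algebra_simps eq_neg_iff_add_eq_0)
      qed (auto simp: p_def q_def v(1)[simplified])
    qed
    then show "\<exists>\<alpha> \<beta>. \<forall>j<s + 3. v j = \<alpha> * p j + \<beta> * q j"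
      by blast
  qed
qed

text \<open>If \<open>I\<close> contains the last index, the submatrix has a zero row. Otherwise
  \<open>I\<close> omits the last index and one more index \<open>m\<close>. The kernel lies in the
  hyperplane of the last coordinate, and being two-dimensional it contains a non-zero vector
  vanishing at \<open>m\<close>; this restricts to a kernel vector of the submatrix.\<close>

lemma family_in_locus:
  fixes \<theta> :: "nat \<times> nat \<Rightarrow> 'a::field"
  assumes "nondeg s \<theta> \<noteq> 0"
  shows "family s \<theta> \<in> principal_minor_locus (s + 3) (s + 1) (s + 1)"
proof -
  let ?A = "family s \<theta>"
  obtain p q where pq: "ker_pair (s + 3) ?A s (s + 1) p q" "spans_ker (s + 3) ?A p q"
    using family_ker_pair[OF assms] by blast
  have "\<theta> (s, s + 2) \<noteq> 0"
    using assms by (auto simp: nondeg_def)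
  note iff = family_in_ker_iff[of \<theta>, OF this]
  have ker: "in_ker (s + 3) ?A p" "in_ker (s + 3) ?A q" and gauge: "p s = 1" "p (s + 1) = 0" "q s = 0" "q (s + 1) = 1"
    using pq(1) by (auto simp: ker_pair_def)
  have minor: "principal_minor ?A I = 0" if I: "I \<subseteq> {..<s + 3}" "card I = s + 1" for I
  proof (cases "s + 2 \<in> I")
    case True
    then show ?thesis
      by (intro principal_minor_zero_row[OF family_carrier I(1)]) (auto simp: family_bottom)
  next
    case False
    then have sub: "I \<subseteq> {..<s + 2}"
      using I(1) by (auto simp: less_Suc_eq numeral_3_eq_3)
    then have "card ({..<s + 2} - I) = 1"
      using I(2) finite_subset[OF sub] by (subst card_Diff_subset) auto
    then obtain m where "{..<s + 2} - I = {m}"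
      using card_1_singletonE by blast
    then have m: "m < s + 2" "m \<notin> I" "\<And>j. j < s + 2 \<Longrightarrow> j \<noteq> m \<Longrightarrow> j \<in> I"
      by auto
    have "\<exists>v. in_ker (s + 3) ?A v \<and> v m = 0 \<and> (v s \<noteq> 0 \<or> v (s + 1) \<noteq> 0)"
    proof (cases "p m = 0 \<and> q m = 0")
      case True
      then show ?thesis
        using ker gauge by (intro exI[of _ p]) auto
    next
      case False
      then show ?thesis
        using in_ker_lincomb[OF ker, of "q m" "- p m"] gauge
        by (intro exI[of _ "\<lambda>j. q m * p j + - p m * q j"]) auto
    qed
    then obtain v where v: "in_ker (s + 3) ?A v" "v m = 0" "v s \<noteq> 0 \<or> v (s + 1) \<noteq> 0"
      by blast
    have out: "v j = 0" if "j < s + 3" "j \<notin> I" for j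
    proof (cases "j = s + 2")
      case True
      then show ?thesis
        using v(1) iff by simp
    next
      case False
      then have "j = m"
        using m(3)[of j] that by force
      then show ?thesis
        using v(2) by simp
    qed
    have "(\<Sum>j\<in>I. ?A $$ (i, j) * v j) = 0" if "i \<in> I" for i
    proof -
      have "(\<Sum>j\<in>I. ?A $$ (i, j) * v j) = (\<Sum>j<s + 3. ?A $$ (i, j) * v j)"
        using I(1) out by (intro sum.mono_neutral_left) auto
      then show ?thesis
        using v(1) that I(1) by (auto simp: in_ker_def)
    qed
    moreover have "\<exists>j\<in>I. v j \<noteq> 0"
      using v(3) out[of s] out[of "s + 1"] by auto
    ultimately show ?thesis
      unfolding principal_minor_eq_0_iff[OF family_carrier I(1)] by blast
  qed
  show ?thesis
    unfolding principal_minor_locus_def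
    using rank_if_ker_pair[OF family_carrier pq] minor by simp
qed

section \<open>Slices of the parameter space\<close>

definition base_point :: "nat \<Rightarrow> nat \<times> nat \<Rightarrow> 'a::comm_ring_1" where
  "base_point s ij = (if fst ij = snd ij \<and> fst ij < s \<or> ij = (s, s + 2) then 1 else 0)"

text \<open>The positions of \<open>M\<close> and \<open>u\<close>, whose parameters always appear
  unchanged in the matrix.\<close>

definition direct_params :: "nat \<Rightarrow> (nat \<times> nat) set" where
  "direct_params s = {..<s} \<times> ({..<s} \<union> {s + 2})"

text \<open>The positions of \<open>B\<close>, \<open>w\<close> and \<open>C\<close>.\<close>

definition other_params :: "nat \<Rightarrow> (nat \<times> nat) set" where
  "other_params s = {s, s + 1} \<times> ({..<s} \<union> {s + 2}) \<union> {..<s} \<times> {s, s + 1}"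

text \<open>The parameters outside \<open>T\<close> are frozen at the base point, where
  \<open>M\<close> is the identity, \<open>w = (1, 0)\<close> and \<open>C, u, B\<close>
  vanish.\<close>

definition slice :: "nat \<Rightarrow> (nat \<times> nat) set \<Rightarrow> (nat \<times> nat \<Rightarrow> 'a::comm_ring_1) set" where
  "slice s T = {\<theta>. nondeg s \<theta> \<noteq> 0 \<and> (\<forall>ij. ij \<notin> T \<longrightarrow> \<theta> ij = base_point s ij)}"

lemma nondeg_base_point: "nondeg s (base_point s) = (1 :: 'a::comm_ring_1)"
proof -
  have "mat s s (base_point s) = (1\<^sub>m s :: 'a mat)"
    by (intro eq_matI) (auto simp: base_point_def)
  then show ?thesis
    by (simp add: nondeg_def base_point_def)
qed

lemma family_entry_direct:
  "ij \<in> direct_params s \<Longrightarrow> family s \<theta> $$ ij = \<theta> ij"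
  by (auto simp: direct_params_def family_top top_row_def)

text \<open>For \<open>M\<close> the identity and \<open>u = 0\<close>, the blocks
  \<open>BM, Bu + w, MC\<close> reduce to \<open>B, w, C\<close>.\<close>

lemma family_entry_other:
  fixes \<theta> :: "nat \<times> nat \<Rightarrow> 'a::comm_ring_1"
  assumes base: "\<And>ij. ij \<in> direct_params s \<Longrightarrow> \<theta> ij = base_point s ij" and ij: "ij \<in> other_params s"
  shows "family s \<theta> $$ ij = \<theta> ij"
proof -
  have M: "\<theta> (k, l) = (if k = l then 1 else 0)" if "k < s" "l < s" for k l
    using base[of "(k, l)"] that by (simp add: direct_params_def base_point_def)
  have u: "\<theta> (k, j) = 0" if "k < s" "j = s + 2" for k j
    using base[of "(k, s + 2)"] that by (simp add: direct_params_def base_point_def)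
  obtain i j where [simp]: "ij = (i, j)"
    by fastforce
  consider "i = s \<or> i = s + 1" "j < s" | "i = s \<or> i = s + 1" "j = s + 2" | "i < s" "j = s \<or> j = s + 1"
    using ij by (auto simp: other_params_def)
  then show ?thesis
  proof cases
    case 1
    have "(\<Sum>k<s. \<theta> (i, k) * top_row s \<theta> k j) = (\<Sum>k<s. if k = j then \<theta> (i, k) else 0)"
      using 1 by (intro sum.cong) (auto simp: top_row_def M)
    then show ?thesis
      using 1 by (auto simp: family_middle)
  next
    case 2
    have "(\<Sum>k<s. \<theta> (i, k) * top_row s \<theta> k j) = 0"
      using 2 by (intro sum.neutral) (auto simp: top_row_def u)
    then show ?thesis
      using 2 by (auto simp: family_middle)
  next
    case 3
    have "(\<Sum>l<s. \<theta> (i, l) * \<theta> (l, j)) = (\<Sum>l<s. if l = i then \<theta> (l, j) else 0)"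
      by (intro sum.cong refl) (use 3 in \<open>auto simp: M\<close>)
    then show ?thesis
      using 3 by (auto simp: family_top top_row_def)
  qed
qed

lemma nondeg_gen_alg:
  assumes "\<And>ij. (\<lambda>t. \<theta> t ij) \<in> gen_alg X G"
  shows "(\<lambda>t. nondeg s (\<theta> t)) \<in> gen_alg X G"
  unfolding nondeg_def by (intro gen_alg_mult det_gen_alg assms)

lemma regular_family_gen_alg:
  assumes f: "f \<in> regular (s + 3)" and \<theta>: "\<And>ij. (\<lambda>t. \<theta> t ij) \<in> gen_alg X G"
  shows "(\<lambda>t. f (family s (\<theta> t))) \<in> gen_alg X G"
proof (rule gen_alg_comp[OF f])
  have top: "(\<lambda>t. top_row s (\<theta> t) k j) \<in> gen_alg X G" for k j
    unfolding top_row_def by (cases "j = s \<or> j = s + 1") (auto intro!: gen_alg_sum gen_alg_mult \<theta>)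
  have "(\<lambda>t. family s (\<theta> t) $$ (i, j)) \<in> gen_alg X G" if "i < s + 3" "j < s + 3" for i j
  proof -
    consider "i < s" | "i = s \<or> i = s + 1" | "i = s + 2"
      using \<open>i < s + 3\<close> by linarith
    then show ?thesis
    proof cases
      case 1
      then show ?thesis
        using that top by (simp add: family_top)
    next
      case 2
      have "(\<lambda>t. (\<Sum>k<s. \<theta> t (i, k) * top_row s (\<theta> t) k j) + (if j = s + 2 then \<theta> t (i, j) else 0))
          \<in> gen_alg X G"
        by (cases "j = s + 2") (auto intro!: gen_alg_add gen_alg_sum gen_alg_mult gen_alg_const \<theta> top)
      then show ?thesis
        using 2 that by (simp only: family_middle)
    next
      case 3
      then show ?thesis
        using that by (simp add: family_bottom gen_alg_const)
    qed
  qed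
  then show "(\<lambda>t. g (family s (\<theta> t))) \<in> gen_alg X G" if "g \<in> mat_coords (s + 3)" for g
    using that by (auto simp: mat_coords_def)
qed simp

lemma prime_on_slice:
  assumes inf: "infinite (UNIV :: 'a::field set)"
  shows "prime_on (regular (s + 3)) (family s ` slice s T :: 'a mat set)"
  unfolding prime_on_def
proof (intro conjI ballI impI)
  show "family s ` slice s T \<noteq> ({} :: 'a mat set)"
    using nondeg_base_point[where ?'a = 'a, of s] by (auto simp: slice_def intro!: exI[of _ "base_point s"])
  fix f g :: "'a mat \<Rightarrow> 'a"
  assume fg: "f \<in> regular (s + 3)" "g \<in> regular (s + 3)" "\<forall>A\<in>family s ` slice s T. f A * g A = 0"
  show "(\<forall>A\<in>family s ` slice s T. f A = 0) \<or> (\<forall>A\<in>family s ` slice s T. g A = 0)"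
  proof (rule ccontr)
    assume "\<not> ?thesis"
    then obtain \<theta>0 \<theta>1 where \<theta>: "\<theta>0 \<in> slice s T" "\<theta>1 \<in> slice s T" "f (family s \<theta>0) \<noteq> 0" "g (family s \<theta>1) \<noteq> 0"
      by blast
    define \<theta> where "\<theta> t ij = \<theta>0 ij + t * (\<theta>1 ij - \<theta>0 ij)" for t ij
    have gen: "(\<lambda>t. \<theta> t ij) \<in> gen_alg UNIV {\<lambda>t. t}" for ij
      unfolding \<theta>_def by (intro gen_alg_add gen_alg_mult gen_alg_const gen_alg_gen) simp
    have ends: "\<theta> 0 = \<theta>0" "\<theta> 1 = \<theta>1"
      by (auto simp: \<theta>_def)
    let ?f = "\<lambda>t. f (family s (\<theta> t))" and ?g = "\<lambda>t. g (family s (\<theta> t))" and ?h = "\<lambda>t. nondeg s (\<theta> t)"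
    have alg: "?f \<in> gen_alg UNIV {\<lambda>t. t}" "?g \<in> gen_alg UNIV {\<lambda>t. t}" "?h \<in> gen_alg UNIV {\<lambda>t. t}"
      using regular_family_gen_alg[OF fg(1) gen] regular_family_gen_alg[OF fg(2) gen] nondeg_gen_alg[OF gen] by auto
    have "?h 0 \<noteq> 0"
      using \<theta>(1) by (simp add: ends slice_def)
    then obtain t0 where t0: "?f t0 \<noteq> 0 \<and> ?h t0 \<noteq> 0"
      using line_common_nonzero[OF inf alg(1,3), of 0 0] \<theta>(3) by (auto simp: ends)
    then obtain t where t: "?f t * ?h t \<noteq> 0" "?g t \<noteq> 0"
      using line_common_nonzero[OF inf gen_alg_mult[OF alg(1,3)] alg(2), of t0 1] \<theta>(4) by (auto simp: ends)
    have "\<theta>0 ij = base_point s ij" "\<theta>1 ij = base_point s ij" if "ij \<notin> T" for ij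
      using \<theta>(1,2) that unfolding slice_def by blast+
    then have "\<theta> t ij = base_point s ij" if "ij \<notin> T" for ij
      using that by (simp add: \<theta>_def)
    then have "\<theta> t \<in> slice s T"
      using t by (auto simp: slice_def)
    then show False
      using fg(3) t by auto
  qed
qed

text \<open>The matrix entry at \<open>ij\<close> equals the freed parameter, so its difference from
  the base value separates the two slices. For \<open>B, w, C\<close> this needs \<open>M\<close>
  and \<open>u\<close> to be still frozen.\<close>

lemma slice_separated:
  assumes inf: "infinite (UNIV :: 'a::field set)"
    and ij: "ij \<notin> T" "ij \<in> direct_params s \<or> ij \<in> other_params s \<and> T \<inter> direct_params s = {}"
  shows "\<exists>f\<in>regular (s + 3). (\<forall>A\<in>family s ` slice s T. f A = 0) \<and>
    (\<exists>A\<in>family s ` slice s (insert ij T). f A \<noteq> (0 :: 'a))"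
proof -
  let ?b = "base_point s :: nat \<times> nat \<Rightarrow> 'a"
  let ?f = "\<lambda>A. A $$ ij - ?b ij"
  have entry: "family s \<theta> $$ ij = \<theta> ij" if agree: "\<And>kl. kl \<notin> insert ij T \<Longrightarrow> \<theta> kl = ?b kl" for \<theta>
  proof (cases "ij \<in> direct_params s")
    case True
    then show ?thesis
      by (rule family_entry_direct)
  next
    case False
    then have other: "ij \<in> other_params s" "T \<inter> direct_params s = {}"
      using ij(2) by auto
    show ?thesis
    proof (rule family_entry_other[OF _ other(1)])
      fix kl assume "kl \<in> direct_params s"
      then have "kl \<notin> insert ij T"
        using other(2) False by blast
      then show "\<theta> kl = ?b kl"
        by (rule agree)
    qed
  qed
  have "direct_params s \<union> other_params s \<subseteq> {..<s + 3} \<times> {..<s + 3}"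
    by (auto simp: direct_params_def other_params_def)
  then have "ij \<in> {..<s + 3} \<times> {..<s + 3}"
    using ij(2) by blast
  then have "?f \<in> regular (s + 3)"
    by (intro gen_alg_diff gen_alg_const gen_alg_gen) (simp add: mat_coords_def)
  moreover have "?f A = 0" if A: "A \<in> family s ` slice s T" for A
  proof -
    obtain \<theta> where \<theta>: "A = family s \<theta>" "\<And>kl. kl \<notin> T \<Longrightarrow> \<theta> kl = ?b kl"
      using A unfolding slice_def by blast
    then show ?thesis
      using entry[of \<theta>] ij(1) by simp
  qed
  moreover have "\<exists>A\<in>family s ` slice s (insert ij T). ?f A \<noteq> 0"
  proof -
    \<comment> \<open>Only the parameter \<open>ij\<close> moves; a value is wanted that differs
      from the base value and keeps the point non-degenerate.\<close>
    define \<theta> where "\<theta> t = ?b(ij := t)" for t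
    have "(\<lambda>t. \<theta> t kl) \<in> gen_alg UNIV {\<lambda>t. t}" for kl
      by (cases "kl = ij") (auto simp: \<theta>_def intro: gen_alg_gen gen_alg_const)
    then have h: "(\<lambda>t. nondeg s (\<theta> t)) \<in> gen_alg UNIV {\<lambda>t. t}"
      by (rule nondeg_gen_alg)
    have l: "(\<lambda>t. t - ?b ij) \<in> gen_alg UNIV {\<lambda>t. t}"
      by (intro gen_alg_diff gen_alg_const gen_alg_gen) simp
    have "\<theta> (?b ij) = ?b"
      by (simp add: \<theta>_def)
    then have "nondeg s (\<theta> (?b ij)) \<noteq> 0"
      by (simp add: nondeg_base_point)
    moreover have "?b ij + 1 - ?b ij \<noteq> 0"
      by simp
    ultimately obtain t where t: "nondeg s (\<theta> t) \<noteq> 0" "t - ?b ij \<noteq> 0"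
      using line_common_nonzero[OF inf h l] by blast
    then have "\<theta> t \<in> slice s (insert ij T)"
      by (auto simp: slice_def \<theta>_def)
    moreover have "family s (\<theta> t) $$ ij = t"
      using entry[of "\<theta> t"] by (simp add: \<theta>_def)
    ultimately show ?thesis
      using t(2) by force
  qed
  ultimately show ?thesis
    by (intro bexI[of _ ?f] conjI ballI)
qed

text \<open>The chain frees one parameter at a time, \<open>4s + 2\<close> of them in
  \<open>B, w, C\<close> and \<open>s * (s + 1)\<close> in \<open>M, u\<close>.\<close>

proposition krull_dim_principal_minor_locus_ge:
  assumes inf: "infinite (UNIV :: 'a::field set)"
  shows "ereal (real (s * s + 5 * s + 2)) \<le> krull_dim (subtopology (zariski_topology (s + 3))
    (principal_minor_locus (s + 3) (s + 1) (s + 1) :: 'a mat set))"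
proof -
  let ?d = "s * s + 5 * s + 2"
  have fin: "finite (other_params s)" "finite (direct_params s)"
    by (auto simp: other_params_def direct_params_def)
  obtain xs ys where xs: "set xs = other_params s" "distinct xs" and ys: "set ys = direct_params s" "distinct ys"
    using finite_distinct_list[OF fin(1)] finite_distinct_list[OF fin(2)] by blast
  \<comment> \<open>The order matters: \<open>B, w, C\<close> are freed first, while
    \<open>M\<close> and \<open>u\<close> still have their base values.\<close>
  define L where "L = xs @ ys"
  have disj: "other_params s \<inter> direct_params s = {}"
    by (auto simp: other_params_def direct_params_def)
  then have dist: "distinct L"
    using xs ys by (simp add: L_def)
  have c: "card ({..<s} \<union> {s + 2}) = s + 1" "card {s, s + 1} = 2"
    by simp_all
  have "card (other_params s) = card ({s, s + 1} \<times> ({..<s} \<union> {s + 2})) + card ({..<s} \<times> {s, s + 1})"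
    unfolding other_params_def by (intro card_Un_disjoint) auto
  then have "card (other_params s) = 2 * (s + 1) + s * 2"
    unfolding card_cartesian_product c by simp
  moreover have "card (direct_params s) = s * (s + 1)"
    unfolding direct_params_def card_cartesian_product c by simp
  ultimately have len: "length L = ?d"
    using xs ys distinct_card[of xs] distinct_card[of ys] by (simp add: L_def algebra_simps)
  define T where "T i = set (take i L)" for i
  have T_Suc: "T (Suc i) = insert (L ! i) (T i)" if "i < ?d" for i
    using that len by (simp add: T_def take_Suc_conv_app_nth)
  have notin: "L ! i \<notin> T i" if "i < ?d" for i
    using that len dist by (auto simp: T_def in_set_conv_nth nth_eq_iff_index_eq)
  show ?thesis
  proof (rule krull_dim_ge[where \<Phi> = "\<lambda>i. family s ` slice s (T i)"])
    show "principal_minor_locus (s + 3) (s + 1) (s + 1) \<subseteq> (carrier_mat (s + 3) (s + 3) :: 'a mat set)"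
      by (auto simp: principal_minor_locus_def)
    show "family s ` slice s (T i) \<subseteq> (principal_minor_locus (s + 3) (s + 1) (s + 1) :: 'a mat set)" for i
      using family_in_locus by (auto simp: slice_def)
    show "prime_on (regular (s + 3)) (family s ` slice s (T i) :: 'a mat set)" for i
      by (rule prime_on_slice[OF inf])
    fix i assume i: "i < ?d"
    show "family s ` slice s (T i) \<subseteq> (family s ` slice s (T (Suc i)) :: 'a mat set)"
      by (rule image_mono) (auto simp: slice_def T_Suc[OF i])
    have "L ! i \<in> direct_params s \<or> L ! i \<in> other_params s \<and> T i \<inter> direct_params s = {}"
    proof (cases "i < length xs")
      case True
      then have "T i \<subseteq> set xs" "L ! i \<in> set xs"
        by (auto simp: T_def L_def nth_append dest: in_set_takeD)
      then show ?thesis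
        using xs disj by blast
    next
      case False
      then have "L ! i \<in> set ys"
        using i len by (simp add: L_def nth_append)
      then show ?thesis
        using ys by simp
    qed
    from slice_separated[OF inf notin[OF i] this]
    show "\<exists>f\<in>regular (s + 3). (\<forall>A\<in>family s ` slice s (T i). f A = 0) \<and>
        (\<exists>A\<in>family s ` slice s (T (Suc i)). f A \<noteq> (0 :: 'a))"
      by (simp add: T_Suc[OF i])
  qed
qed

theorem theorem3:
  fixes n :: nat
  assumes "n \<ge> 3"
  shows "krull_dim (subtopology (zariski_topology n)
           (principal_minor_locus n (n - 2) (n - 2) :: 'a::alg_closed_field mat set)) =
         ereal (real n ^ 2 - 4 - real n)"
proof -
  obtain s where s: "n = s + 3"
    using assms by (metis add.commute le_Suc_ex)
  \<comment> \<open>Writing \<open>n = s + 3\<close> turns the truncated subtractions of the two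
    bounds into one polynomial in \<open>s\<close>.\<close>
  have card: "n * n - n - 4 = s * s + 5 * s + 2" and sub: "n - 2 = s + 1"
    by (simp_all add: s algebra_simps)
  have real: "real (s * s + 5 * s + 2) = real n ^ 2 - 4 - real n"
    by (simp add: s power2_eq_square algebra_simps)
  show ?thesis
    using krull_dim_principal_minor_locus_le[OF assms, where ?'a = 'a]
      krull_dim_principal_minor_locus_ge[OF infinite_UNIV_alg_closed[where ?'a = 'a], of s]
    unfolding card real sub s[symmetric] by (rule antisym)
qed

end
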